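(* Let $Q$ be a pure $n$-dimensional lattice complex in $\mathbb{R}^n$. Then \[ \sum_{F}(n-1)!\, \mathrm{vol}_{n-1}'(F) = (-1)^{n-1}\sum_{k=0}^{n-1}(-1)^{k}\binom{n-1}{k} B(k\cdot \partial Q), \] where the left sum runs over the facets $F$ of $Q$, i.e. the $(n-1)$-dimensional cells of the boundary complex $\partial Q$.
   Context: A lattice complex is a bounded polyhedral complex all of whose vertices lie in $\mathbb{Z}^n$; it is pure $n$-dimensional if every maximal cell has dimension $n$. $\partial Q$ is the boundary complex of $Q$. For a polyhedral complex $R$ and integer $k\ge1$, $B(k\cdot R)$ is the number of integer points in the dilate $k\cdot|R|$ of the underlying set of $R$, and by convention $B(0\cdot R):=\chi(R)$, the Euler–Poincaré characteristic of $R$. For an $(n-1)$-dimensional lattice polytope $F$, $\mathrm{vol}'_{n-1}(F)$ is its $(n-1)$-dimensional volume normalized so that a fundamental domain of the lattice $\mathbb{Z}^n\cap L$ has volume 1, where $L$ is the linear hyperplane parallel to the affine hull of $F$. *)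

theory Defs
  imports "HOL-Analysis.Analysis"
begin

definition lattice_pt :: "real^'n \<Rightarrow> bool" where
  "lattice_pt x \<longleftrightarrow> (\<forall>i. x $ i \<in> \<int>)"

definition lattice_complex :: "(real^'n) set set \<Rightarrow> bool" where
  "lattice_complex Q \<longleftrightarrow> finite Q \<and>
     (\<forall>C\<in>Q. polytope C \<and> C \<noteq> {} \<and> (\<forall>v. v extreme_point_of C \<longrightarrow> lattice_pt v)) \<and>
     (\<forall>C\<in>Q. \<forall>F. F face_of C \<and> F \<noteq> {} \<longrightarrow> F \<in> Q) \<and>
     (\<forall>C\<in>Q. \<forall>D\<in>Q. (C \<inter> D) face_of C \<and> (C \<inter> D) face_of D)"

definition pure_complex :: "(real^'n) set set \<Rightarrow> nat \<Rightarrow> bool" where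
  "pure_complex Q d \<longleftrightarrow>
     (\<forall>C\<in>Q. (\<forall>D\<in>Q. C \<subseteq> D \<longrightarrow> D = C) \<longrightarrow> aff_dim C = int d)"

definition boundary_complex :: "(real^'n) set set \<Rightarrow> (real^'n) set set" where
  "boundary_complex Q = {C \<in> Q. C \<subseteq> frontier (\<Union>Q)}"

text \<open>Euler-Poincare characteristic (cells are nonempty).\<close>
definition euler_char :: "(real^'n) set set \<Rightarrow> int" where
  "euler_char R = (\<Sum>C\<in>R. (-1) ^ nat (aff_dim C))"

definition B_count :: "nat \<Rightarrow> (real^'n) set set \<Rightarrow> int" where
  "B_count k R = (if k = 0 then euler_char R
     else int (card {x. lattice_pt x \<and> x \<in> (\<lambda>y. real k *\<^sub>R y) ` (\<Union>R)}))"

definition lattice_basis :: "(real^'n) set \<Rightarrow> nat \<Rightarrow> (nat \<Rightarrow> real^'n) \<Rightarrow> bool" where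
  "lattice_basis L m b \<longleftrightarrow>
     (\<forall>i<m. lattice_pt (b i)) \<and>
     (\<forall>t. (\<Sum>i<m. t i *\<^sub>R b i) = 0 \<longrightarrow> (\<forall>i<m. t i = 0)) \<and>
     (\<forall>z. (lattice_pt z \<and> z \<in> L) \<longleftrightarrow>
          (\<exists>c. (\<forall>i<m. c i \<in> \<int>) \<and> z = (\<Sum>i<m. c i *\<^sub>R b i)))"

definition parallel_space :: "(real^'n) set \<Rightarrow> (real^'n) set" where
  "parallel_space F = span ((\<lambda>(x, y). x - y) ` (F \<times> F))"

text \<open>Normalized volume vol'_m(F), m = dim F: the Lebesgue measure of F read in the
  coordinates of a lattice basis of Z^n \<inter> L (so a fundamental domain, the image of the
  unit cube, has volume 1), based at a point p of F.\<close>
definition lattice_vol :: "(real^'n) set \<Rightarrow> real" where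
  "lattice_vol F =
     (let m = nat (aff_dim F);
          b = (SOME b. lattice_basis (parallel_space F) m b);
          p = (SOME p. p \<in> F)
      in measure (PiM {..<m} (\<lambda>_. lborel))
           {t \<in> space (PiM {..<m} (\<lambda>_. lborel)). p + (\<Sum>i<m. t i *\<^sub>R b i) \<in> F})"

end

theory Submission
  imports Defs "HOL-Computational_Algebra.Polynomial"
begin

text \<open>
  For a lattice polytope \<open>C\<close> let \<open>N k\<close> be the number of lattice points in \<open>k\<close> times the relative interior
  of \<open>C\<close>. Pulling vertices dissects the relative interior into relatively open lattice simplices,
  and splitting barycentric coordinates as \<open>u = q + r\<close> with \<open>q \<in> \<nat>\<close> and \<open>0 < r \<le> 1\<close> counts the points
  of such a simplex by binomial coefficients. So \<open>N\<close> is a polynomial of degree at most \<open>dim C\<close>, and its value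
  at \<open>0\<close> is the sum of the signs \<open>(-1)^dim\<close> of the simplices. This sum is \<open>(-1)^dim C\<close>, because
  the sign is additive over dissections into relatively open polytopes (slice by hyperplanes and induct on the dimension).
  The coefficient of degree \<open>dim C\<close> is the limit of \<open>N k / k^dim C\<close>, which is the normalized volume.
  Summing over the cells of the boundary complex, whose relative interiors partition its support, the
  alternating binomial sum extracts \<open>(n-1)!\<close> times the coefficients of degree \<open>n-1\<close>, and hence only sees the facets.
\<close>

section \<open>Additivity of the Euler characteristic\<close>

text \<open>The delicate point is the value at 0. The dilate by 0 of a nonempty set is a single
  point, whereas the convention B(0) = chi asks each cell for its sign, so the constant term cannot
  be obtained by counting at 0. On an open simplex of dimension e it is the generalized binomial
  coefficient of -1 over e, which is (-1)^e. For a general cell it becomes a sum of signs over a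
  dissection. The dissections of different faces are chosen independently, so the pieces need not
  fit together as a complex, and additivity of the sign over arbitrary disjoint unions takes the
  place of an Euler relation for complexes. It is phrased as the vanishing of a weighted sum: this
  form survives slicing, and the signs of the slices can be absorbed into the weights. Relative
  interiors are counted instead of closed cells because they add up without inclusion-exclusion. Up
  to the factor (-1)^d, the alternating binomial sum is the d-th forward difference at 0. It
  annihilates degrees below d and turns a leading coefficient c into d! c, so only the top
  coefficient has to be identified.\<close>

text \<open>Sum \<open>\<phi> t - \<phi> (t + \<delta>)\<close> over all endpoints \<open>t\<close>, with \<open>\<delta>\<close> below every gap: a point
  contributes \<open>1\<close>, an open interval \<open>- 1\<close> (only its left endpoint counts).\<close>

lemma euler_additive_real:
  fixes l u \<alpha> :: "'i \<Rightarrow> real"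
  assumes fin: "finite I" and le: "\<And>i. i \<in> I \<Longrightarrow> l i \<le> u i"
    and zero: "\<And>t. (\<Sum>i\<in>I. if l i = t \<and> u i = t \<or> l i < t \<and> t < u i then \<alpha> i else 0) = 0"
  shows "(\<Sum>i\<in>I. if l i = u i then \<alpha> i else - \<alpha> i) = 0"
proof -
  define V where "V = l ` I \<union> u ` I"
  define \<phi> where "\<phi> i t = (if l i = t \<and> u i = t \<or> l i < t \<and> t < u i then \<alpha> i else 0)" for i t
  have finV: "finite V" unfolding V_def using fin by simp
  obtain \<delta> where \<delta>: "\<delta> > 0" "\<And>s t. s \<in> V \<Longrightarrow> t \<in> V \<Longrightarrow> s < t \<Longrightarrow> s + \<delta> < t"
  proof -
    define W where "W = insert 1 ((\<lambda>(s, t). t - s) ` {(s, t) \<in> V \<times> V. s < t})"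
    have "finite {(s, t) \<in> V \<times> V. s < t}"
      by (rule finite_subset[of _ "V \<times> V"]) (use finV in auto)
    then have finW: "finite W" unfolding W_def by simp
    have pos: "w > 0" if "w \<in> W" for w
      using that unfolding W_def by auto
    have "Min W > 0"
      using pos finW by (simp add: W_def)
    moreover have "s + Min W / 2 < t" if "s \<in> V" "t \<in> V" "s < t" for s t
    proof -
      have "t - s \<in> W" unfolding W_def using that by force
      then have "Min W \<le> t - s" using finW by simp
      with \<open>Min W > 0\<close> show ?thesis by linarith
    qed
    ultimately show ?thesis by (intro that[of "Min W / 2"]) auto
  qed
  have one: "(\<Sum>t\<in>V. \<phi> i t - \<phi> i (t + \<delta>)) = (if l i = u i then \<alpha> i else - \<alpha> i)" if i: "i \<in> I" for i
  proof -
    have V: "l i \<in> V" "u i \<in> V" unfolding V_def using i by auto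
    show ?thesis
    proof (cases "l i = u i")
      case True
      have "\<phi> i t - \<phi> i (t + \<delta>) = (if t = l i then \<alpha> i else 0)" if "t \<in> V" for t
        using \<delta>(2)[OF that V(1)] \<delta>(1) True unfolding \<phi>_def by auto
      then show ?thesis using True finV V by (simp add: sum.delta)
    next
      case False
      with le[OF i] have lu: "l i < u i" by simp
      have "\<phi> i t - \<phi> i (t + \<delta>) = (if t = l i then - \<alpha> i else 0)" if "t \<in> V" for t
        using \<delta>(2)[OF that V(1)] \<delta>(2)[OF that V(2)] \<delta>(1) lu unfolding \<phi>_def by (cases "t = l i"; cases "t < l i"; cases "t < u i"; force)
      then show ?thesis using False finV V by (simp add: sum.delta)
    qed
  qed
  have "(\<Sum>i\<in>I. if l i = u i then \<alpha> i else - \<alpha> i) = (\<Sum>i\<in>I. \<Sum>t\<in>V. \<phi> i t - \<phi> i (t + \<delta>))"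
    by (intro sum.cong refl) (simp add: one)
  also have "\<dots> = (\<Sum>t\<in>V. (\<Sum>i\<in>I. \<phi> i t) - (\<Sum>i\<in>I. \<phi> i (t + \<delta>)))"
    by (subst sum.swap) (simp add: sum_subtractf)
  also have "\<dots> = 0" using zero unfolding \<phi>_def by simp
  finally show ?thesis .
qed

text \<open>\<open>rel_interior C\<close> cut by the hyperplane is nonempty and open in the affine
  set \<open>?A \<inter> ?T\<close>, so it already spans that set affinely. The dimension of the
  slice is therefore that of an affine set cut by a hyperplane.\<close>

lemma rel_interior_hyperplane_slice:
  fixes C :: "'a::euclidean_space set"
  assumes "convex C" and ne: "rel_interior C \<inter> {x. a \<bullet> x = t} \<noteq> {}"
  shows "rel_interior (C \<inter> {x. a \<bullet> x = t}) = rel_interior C \<inter> {x. a \<bullet> x = t}"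
    and "aff_dim (C \<inter> {x. a \<bullet> x = t}) = (if C \<subseteq> {x. a \<bullet> x = t} then aff_dim C else aff_dim C - 1)"
proof -
  let ?T = "{x. a \<bullet> x = t}" and ?A = "affine hull C"
  have T: "affine ?T" by (simp add: affine_hyperplane)
  show "rel_interior (C \<inter> ?T) = rel_interior C \<inter> ?T"
    using convex_affine_rel_interior_Int[OF assms(1) T ne] .
  have AT: "affine (?A \<inter> ?T)" using T by (simp add: affine_Int)
  have "openin (top_of_set (?A \<inter> ?T)) (rel_interior C \<inter> ?T)"
    using openin_subtopology_Int2 openin_rel_interior
    by (metis (no_types, lifting) inf_commute openin_subtopology_Int_subset subtopology_subtopology openin_subtopology_Int)
  then have "openin (top_of_set (affine hull (?A \<inter> ?T))) (rel_interior C \<inter> ?T)"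
    using AT by (simp add: affine_hull_eq hull_same)
  then have "affine hull (rel_interior C \<inter> ?T) = ?A \<inter> ?T"
    using affine_hull_openin ne AT by (metis affine_hull_eq)
  moreover have "affine hull (rel_interior C \<inter> ?T) \<subseteq> affine hull (C \<inter> ?T)"
    by (intro hull_mono Int_mono rel_interior_subset order_refl)
  moreover have "affine hull (C \<inter> ?T) \<subseteq> ?A \<inter> ?T"
    by (intro hull_minimal Int_mono hull_subset order_refl AT)
  ultimately have "affine hull (C \<inter> ?T) = ?A \<inter> ?T" by (simp only: subset_antisym)
  then have "aff_dim (C \<inter> ?T) = aff_dim (?A \<inter> ?T)" by (metis aff_dim_affine_hull)
  also have "\<dots> = (if ?A \<subseteq> ?T then aff_dim C else aff_dim C - 1)"
    using ne rel_interior_subset hull_subset[of C affine]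
    by (subst aff_dim_affine_Int_hyperplane) auto
  also have "?A \<subseteq> ?T \<longleftrightarrow> C \<subseteq> ?T"
    using T by (metis hull_minimal hull_subset subset_trans)
  finally show "aff_dim (C \<inter> ?T) = (if C \<subseteq> ?T then aff_dim C else aff_dim C - 1)" .
qed

text \<open>Linear images commute with relative interiors of convex sets, and the image of
  \<open>C\<close> is a compact interval. The levels met by \<open>rel_interior C\<close> thus form
  the relative interior of that interval, in the shape that \<open>euler_additive_real\<close>
  expects.\<close>

lemma inner_image_rel_interior_polytope:
  fixes C :: "'a::euclidean_space set"
  assumes "polytope C" "C \<noteq> {}"
  obtains l u where "l \<le> u" "l = u \<longleftrightarrow> C \<subseteq> {x. a \<bullet> x = l}"
    and "\<And>t. rel_interior C \<inter> {x. a \<bullet> x = t} \<noteq> {} \<longleftrightarrow> l = t \<and> u = t \<or> l < t \<and> t < u"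
proof -
  let ?h = "\<lambda>x. a \<bullet> x"
  have lin: "linear ?h" by (simp add: bounded_linear.linear bounded_linear_inner_right)
  have "compact (?h ` C)" "connected (?h ` C)" "?h ` C \<noteq> {}"
    using assms polytope_imp_compact polytope_imp_convex convex_connected
    by (auto intro!: compact_continuous_image connected_continuous_image continuous_intros)
  then obtain l u where lu: "?h ` C = {l..u}"
    using connected_compact_interval_1 by (metis box_real(2))
  have le: "l \<le> u" using lu \<open>?h ` C \<noteq> {}\<close> by auto
  have eq: "?h ` rel_interior C = rel_interior {l..u}"
    using rel_interior_convex_linear_image[OF lin polytope_imp_convex[OF assms(1)]] lu by simp
  have ri: "rel_interior {l..u} = (if l = u then {l} else {l<..<u})"
    using le by auto
  have flat: "l = u \<longleftrightarrow> C \<subseteq> {x. a \<bullet> x = l}"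
  proof
    assume "l = u"
    then show "C \<subseteq> {x. a \<bullet> x = l}" using lu by (auto simp: set_eq_iff)
  next
    assume *: "C \<subseteq> {x. a \<bullet> x = l}"
    have "u \<in> ?h ` C" using lu le by simp
    then show "l = u" using * by auto
  qed
  have "rel_interior C \<inter> {x. a \<bullet> x = t} \<noteq> {} \<longleftrightarrow> t \<in> ?h ` rel_interior C" for t
    by auto
  then have "rel_interior C \<inter> {x. a \<bullet> x = t} \<noteq> {} \<longleftrightarrow> l = t \<and> u = t \<or> l < t \<and> t < u" for t
    using ri le unfolding eq by auto
  with le flat show ?thesis by (rule that)
qed

text \<open>For each level of a linear form, the induction hypothesis applied to the slices gives a
  relation in smaller dimension. These relations, over all levels, are the hypothesis of the
  one-dimensional case. A dissection is the special case with weight -1 on the whole and 1 on the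
  pieces.\<close>

lemma euler_additive:
  fixes C :: "'i \<Rightarrow> 'a::euclidean_space set" and \<alpha> :: "'i \<Rightarrow> real"
  assumes "finite I" and "\<And>i. i \<in> I \<Longrightarrow> polytope (C i)" "\<And>i. i \<in> I \<Longrightarrow> C i \<noteq> {}"
    and "\<And>x. (\<Sum>i\<in>I. if x \<in> rel_interior (C i) then \<alpha> i else 0) = 0"
  shows "(\<Sum>i\<in>I. \<alpha> i * (- 1) ^ nat (aff_dim (C i))) = 0"
  using assms
proof (induction "nat (aff_dim (\<Union>i\<in>I. C i))" arbitrary: I C \<alpha> rule: less_induct)
  case less
  let ?U = "\<Union>i\<in>I. C i"
  show ?case
  proof (cases "aff_dim ?U \<le> 0")
    case True
    show ?thesis
    proof (cases "I = {}")
      case False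
      then have "?U \<noteq> {}" using less.prems(3) by auto
      then obtain x where x: "?U = {x}"
        using True aff_dim_empty aff_dim_sing by (metis aff_dim_eq_0 aff_dim_geq aff_dim_negative_iff linorder_not_le order_antisym_conv)
      have "C i = {x}" if "i \<in> I" for i
      proof -
        have "C i \<subseteq> {x}" unfolding x[symmetric] using that by (rule UN_upper)
        then show ?thesis using less.prems(3)[OF that] by (simp add: subset_singleton_iff)
      qed
      then show ?thesis using less.prems(4)[of x] by simp
    qed simp
  next
    case False
    obtain x y where xy: "x \<in> ?U" "y \<in> ?U" "x \<noteq> y"
    proof -
      have "\<not> (\<exists>x. ?U \<subseteq> {x})"
        using False by (metis aff_dim_sing aff_dim_subset order_trans)
      then show ?thesis using that by blast
    qed
    \<comment> \<open>Since the form \<open>a \<bullet> _\<close> separates two points of the union,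
      no level set contains the whole union, and the dimension drops in every slice.\<close>
    define a where "a = y - x"
    have axy: "a \<bullet> x \<noteq> a \<bullet> y"
      using xy(3) unfolding a_def by (metis inner_diff_right inner_eq_zero_iff right_minus_eq)
    define R where "R i l u \<longleftrightarrow> l \<le> u \<and> (l = u \<longleftrightarrow> C i \<subseteq> {x. a \<bullet> x = l}) \<and>
      (\<forall>t. rel_interior (C i) \<inter> {x. a \<bullet> x = t} \<noteq> {} \<longleftrightarrow> l = t \<and> u = t \<or> l < t \<and> t < u)" for i l u
    have "\<exists>l u. R i l u" if "i \<in> I" for i
      using inner_image_rel_interior_polytope[OF less.prems(2,3)[OF that], of a] unfolding R_def by metis
    then obtain l u where R: "\<And>i. i \<in> I \<Longrightarrow> R i (l i) (u i)" by metis
    then have le: "\<And>i. i \<in> I \<Longrightarrow> l i \<le> u i"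
      and flat: "\<And>i. i \<in> I \<Longrightarrow> l i = u i \<longleftrightarrow> C i \<subseteq> {x. a \<bullet> x = l i}"
      and slice: "\<And>i t. i \<in> I \<Longrightarrow> rel_interior (C i) \<inter> {x. a \<bullet> x = t} \<noteq> {} \<longleftrightarrow> l i = t \<and> u i = t \<or> l i < t \<and> t < u i"
      unfolding R_def by blast+
    \<comment> \<open>This is the weight times the sign of any slice through the relative interior:
      slicing a cell that is not flat lowers its dimension by one and flips the sign. The
      one-dimensional lemma flips it back.\<close>
    define \<beta> where "\<beta> i = \<alpha> i * (if l i = u i then (- 1) ^ nat (aff_dim (C i)) else - ((- 1) ^ nat (aff_dim (C i))))" for i
    have "(\<Sum>i\<in>I. if l i = t \<and> u i = t \<or> l i < t \<and> t < u i then \<beta> i else 0) = 0" for t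
    proof -
      let ?T = "{x. a \<bullet> x = t}"
      define J where "J = {i\<in>I. rel_interior (C i) \<inter> ?T \<noteq> {}}"
      have J: "J \<subseteq> I" "finite J" using less.prems(1) unfolding J_def by auto
      have ri: "rel_interior (C i \<inter> ?T) = rel_interior (C i) \<inter> ?T"
        and ad: "aff_dim (C i \<inter> ?T) = (if C i \<subseteq> ?T then aff_dim (C i) else aff_dim (C i) - 1)" if "i \<in> J" for i
      proof -
        have "convex (C i)" "rel_interior (C i) \<inter> ?T \<noteq> {}"
          using that less.prems(2) polytope_imp_convex unfolding J_def by auto
        then show "rel_interior (C i \<inter> ?T) = rel_interior (C i) \<inter> ?T"
          and "aff_dim (C i \<inter> ?T) = (if C i \<subseteq> ?T then aff_dim (C i) else aff_dim (C i) - 1)"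
          by (rule rel_interior_hyperplane_slice)+
      qed
      have "aff_dim (\<Union>i\<in>J. C i \<inter> ?T) \<le> aff_dim (affine hull ?U \<inter> ?T)"
        using J hull_subset[of ?U affine] by (intro aff_dim_subset) blast
      also have "\<dots> < aff_dim ?U"
      proof -
        have "\<not> affine hull ?U \<subseteq> ?T"
          using axy xy(1,2) hull_subset[of ?U affine] by (metis (mono_tags, lifting) mem_Collect_eq subset_iff)
        then show ?thesis using False by (subst aff_dim_affine_Int_hyperplane) auto
      qed
      finally have "nat (aff_dim (\<Union>i\<in>J. C i \<inter> ?T)) < nat (aff_dim ?U)"
        using False by simp
      then have "(\<Sum>i\<in>J. \<alpha> i * (- 1) ^ nat (aff_dim (C i \<inter> ?T))) = 0"
      proof (rule less.hyps)
        show "finite J" by fact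
        show "polytope (C i \<inter> ?T)" if "i \<in> J" for i
          using that J less.prems(2) by (auto intro!: polytope_Int_polyhedron polyhedron_hyperplane)
        show "C i \<inter> ?T \<noteq> {}" if "i \<in> J" for i
          using that rel_interior_subset unfolding J_def by blast
        show "(\<Sum>i\<in>J. if x \<in> rel_interior (C i \<inter> ?T) then \<alpha> i else 0) = 0" for x
        proof (cases "x \<in> ?T")
          case True
          have "(\<Sum>i\<in>J. if x \<in> rel_interior (C i \<inter> ?T) then \<alpha> i else 0) = (\<Sum>i\<in>J. if x \<in> rel_interior (C i) then \<alpha> i else 0)"
            using True ri by (intro sum.cong) auto
          also have "\<dots> = (\<Sum>i\<in>I. if x \<in> rel_interior (C i) then \<alpha> i else 0)"
            using J less.prems(1) True by (intro sum.mono_neutral_left) (auto simp: J_def)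
          finally show ?thesis using less.prems(4) by simp
        next
          case False
          then show ?thesis using ri by (intro sum.neutral) auto
        qed
      qed
      moreover have "\<alpha> i * (- 1) ^ nat (aff_dim (C i \<inter> ?T)) = \<beta> i" if i: "i \<in> J" for i
      proof -
        have iI: "i \<in> I" and ne: "rel_interior (C i) \<inter> ?T \<noteq> {}" using i J_def by auto
        have ltu: "l i = t \<and> u i = t \<or> l i < t \<and> t < u i" using slice[OF iI] ne by blast
        show ?thesis
        proof (cases "l i = u i")
          case True
          then have "C i \<subseteq> ?T" using flat[OF iI] ltu by auto
          then show ?thesis using True ad[OF i] unfolding \<beta>_def by simp
        next
          case False
          have "\<not> C i \<subseteq> ?T"
          proof
            assume *: "C i \<subseteq> ?T"
            have "(l i + t) / 2 \<noteq> t" "l i < (l i + t) / 2" "(l i + t) / 2 < u i" using ltu False by auto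
            then have "rel_interior (C i) \<inter> {x. a \<bullet> x = (l i + t) / 2} \<noteq> {}"
              using slice[OF iI] by blast
            then obtain z where "z \<in> rel_interior (C i)" "a \<bullet> z = (l i + t) / 2" by blast
            then show False using * rel_interior_subset \<open>(l i + t) / 2 \<noteq> t\<close> by fastforce
          qed
          \<comment> \<open>The slice is nonempty, so \<open>nat\<close> does not truncate and the
            dimensions really differ by one.\<close>
          moreover have "aff_dim (C i \<inter> ?T) \<ge> 0"
            using ne rel_interior_subset[of "C i"] aff_dim_negative_iff[of "C i \<inter> ?T"] by fastforce
          ultimately have "nat (aff_dim (C i)) = Suc (nat (aff_dim (C i \<inter> ?T)))"
            using ad[OF i] by simp
          then show ?thesis using False unfolding \<beta>_def by simp
        qed
      qed
      ultimately have "(\<Sum>i\<in>J. \<beta> i) = 0" by simp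
      moreover have "(\<Sum>i\<in>I. if l i = t \<and> u i = t \<or> l i < t \<and> t < u i then \<beta> i else 0) = (\<Sum>i\<in>J. \<beta> i)"
        unfolding J_def using slice less.prems(1) by (simp add: sum.inter_filter)
      ultimately show ?thesis by simp
    qed
    then have "(\<Sum>i\<in>I. if l i = u i then \<beta> i else - \<beta> i) = 0"
      using euler_additive_real less.prems(1) le by blast
    moreover have "(if l i = u i then \<beta> i else - \<beta> i) = \<alpha> i * (- 1) ^ nat (aff_dim (C i))" for i
      unfolding \<beta>_def by simp
    ultimately show ?thesis by simp
  qed
qed

section \<open>Dissection into open simplices\<close>

text \<open>Descend through facets: a point outside the relative interior lies on a facet, which has
  smaller dimension. With \<open>face_of_eq\<close> this makes the relative interiors of the
  nonempty faces a partition of the polytope.\<close>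

lemma polytope_in_rel_interior_of_face:
  fixes P :: "'a::euclidean_space set"
  assumes "polytope P" "x \<in> P"
  shows "\<exists>H. H face_of P \<and> x \<in> rel_interior H"
  using assms
proof (induction "nat (aff_dim P + 1)" arbitrary: P rule: less_induct)
  case less
  show ?case
  proof (cases "x \<in> rel_interior P")
    case True
    then show ?thesis using less.prems face_of_refl polytope_imp_convex by blast
  next
    case False
    then have "x \<in> rel_frontier P"
      using less.prems closure_subset unfolding rel_frontier_def by blast
    then obtain F where F: "F facet_of P" "x \<in> F"
      using rel_frontier_of_polyhedron less.prems polytope_imp_polyhedron by blast
    then have face: "F face_of P" and "aff_dim F = aff_dim P - 1" "F \<noteq> {}" unfolding facet_of_def by auto
    then have "nat (aff_dim F + 1) < nat (aff_dim P + 1)"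
      using aff_dim_negative_iff[of F] by auto
    moreover have "polytope F" using face less.prems face_of_polytope_polytope by blast
    ultimately obtain H where "H face_of F" "x \<in> rel_interior H"
      using less.hyps F by blast
    then show ?thesis using face face_of_trans by blast
  qed
qed

text \<open>The open simplex over \<open>insert v S\<close> is an open cone with apex
  \<open>v\<close> over the open simplex of \<open>S\<close>. In barycentric coordinates this
  amounts to rescaling the weights on \<open>S\<close>.\<close>

lemma rel_interior_convex_hull_insert:
  fixes S :: "'a::euclidean_space set"
  assumes ind: "\<not> affine_dependent (insert v S)" and v: "v \<notin> S" and "S \<noteq> {}"
  shows "x \<in> rel_interior (convex hull (insert v S)) \<longleftrightarrow>
    (\<exists>y\<in>rel_interior (convex hull S). x \<in> open_segment v y)"
proof -
  have indS: "\<not> affine_dependent S" using ind affine_dependent_subset by blast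
  have fin: "finite S" using indS aff_independent_finite by blast
  have vaff: "v \<notin> affine hull S"
    using ind v unfolding affine_dependent_def by (metis Diff_insert_absorb insertI1)
  show ?thesis
  proof
    assume "x \<in> rel_interior (convex hull (insert v S))"
    then obtain u where u: "\<forall>s\<in>insert v S. 0 < u s" "sum u (insert v S) = 1"
      "(\<Sum>s\<in>insert v S. u s *\<^sub>R s) = x"
      unfolding rel_interior_convex_hull_explicit[OF ind] by blast
    \<comment> \<open>The total weight on \<open>S\<close>; dividing by it projects \<open>x\<close>
      from \<open>v\<close> to the point \<open>y\<close> of the opposite simplex.\<close>
    define \<mu> where "\<mu> = sum u S"
    have \<mu>0: "\<mu> > 0" unfolding \<mu>_def using u(1) fin assms(3) by (intro sum_pos) auto
    have uv: "u v = 1 - \<mu>" using u(2) v fin unfolding \<mu>_def by simp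
    have \<mu>1: "\<mu> < 1" using u(1) uv by auto
    define y where "y = (\<Sum>s\<in>S. (u s / \<mu>) *\<^sub>R s)"
    have y: "y \<in> rel_interior (convex hull S)"
      unfolding rel_interior_convex_hull_explicit[OF indS] y_def
      using u(1) \<mu>0 by (auto intro!: exI[of _ "\<lambda>s. u s / \<mu>"] simp: sum_divide_distrib[symmetric] \<mu>_def)
    have "x = (1 - \<mu>) *\<^sub>R v + \<mu> *\<^sub>R y"
      using u(3) v fin uv \<mu>0 unfolding y_def by (simp add: scaleR_sum_right)
    moreover have "v \<noteq> y"
      using y vaff rel_interior_subset convex_hull_subset_affine_hull by blast
    ultimately show "\<exists>y\<in>rel_interior (convex hull S). x \<in> open_segment v y"
      using y \<mu>0 \<mu>1 unfolding in_segment(2) by blast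
  next
    assume "\<exists>y\<in>rel_interior (convex hull S). x \<in> open_segment v y"
    then obtain y \<mu> where y: "y \<in> rel_interior (convex hull S)"
      and \<mu>: "0 < \<mu>" "\<mu> < 1" "x = (1 - \<mu>) *\<^sub>R v + \<mu> *\<^sub>R y"
      unfolding in_segment(2) by blast
    then obtain w where w: "\<forall>s\<in>S. 0 < w s" "sum w S = 1" "(\<Sum>s\<in>S. w s *\<^sub>R s) = y"
      unfolding rel_interior_convex_hull_explicit[OF indS] by blast
    define u where "u s = (if s = v then 1 - \<mu> else \<mu> * w s)" for s
    have S: "(\<Sum>s\<in>S. u s) = \<mu> * sum w S" "(\<Sum>s\<in>S. u s *\<^sub>R s) = \<mu> *\<^sub>R (\<Sum>s\<in>S. w s *\<^sub>R s)"
      unfolding sum_distrib_left scaleR_sum_right u_def using v by (auto intro!: sum.cong)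
    have "\<forall>s\<in>insert v S. 0 < u s" using w(1) \<mu> unfolding u_def by auto
    moreover have "sum u (insert v S) = 1" "(\<Sum>s\<in>insert v S. u s *\<^sub>R s) = x"
      using S v fin w \<mu>(3) by (auto simp: u_def)
    ultimately show "x \<in> rel_interior (convex hull (insert v S))"
      unfolding rel_interior_convex_hull_explicit[OF ind] by blast
  qed
qed

text \<open>Of two distinct points on one ray from \<open>v\<close>, the nearer lies strictly
  between \<open>v\<close> and the farther. A face containing the nearer one would then contain
  \<open>v\<close>.\<close>

lemma face_of_ray_unique:
  fixes P :: "'a::euclidean_space set"
  assumes "H face_of P" "H' face_of P" "v \<in> P" "v \<notin> H" "v \<notin> H'" "y \<in> H" "y' \<in> H'"
    and "x \<in> open_segment v y" "x \<in> open_segment v y'"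
  shows "y = y'"
proof -
  \<comment> \<open>The larger parameter belongs to the point nearer to \<open>v\<close>; applying
    this in both orders leaves only equal parameters.\<close>
  have wlog: False if f: "H' face_of P" "v \<notin> H'" "y' \<in> H'" "y \<in> P"
    and x: "x = (1 - \<mu>) *\<^sub>R v + \<mu> *\<^sub>R y" "x = (1 - \<mu>') *\<^sub>R v + \<mu>' *\<^sub>R y'" "v \<noteq> y" "0 < \<mu>" "\<mu> < \<mu>'"
    for H' y y' \<mu> \<mu>'
  proof -
    have "\<mu>' *\<^sub>R (y' - v) = \<mu> *\<^sub>R (y - v)" using x(1,2) by (simp add: algebra_simps)
    then have "(1 / \<mu>') *\<^sub>R (\<mu>' *\<^sub>R (y' - v)) = (\<mu> / \<mu>') *\<^sub>R (y - v)" by simp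
    then have "y' = (1 - \<mu> / \<mu>') *\<^sub>R v + (\<mu> / \<mu>') *\<^sub>R y"
      using x(4,5) by (simp add: algebra_simps)
    moreover have "0 < \<mu> / \<mu>'" "\<mu> / \<mu>' < 1" using x(4,5) by auto
    ultimately have "y' \<in> open_segment v y" unfolding in_segment(2) using x(3) by blast
    then show False using f assms(3) unfolding face_of_def by blast
  qed
  obtain \<mu> where \<mu>: "v \<noteq> y" "0 < \<mu>" "x = (1 - \<mu>) *\<^sub>R v + \<mu> *\<^sub>R y"
    using assms(8) unfolding in_segment(2) by blast
  obtain \<mu>' where \<mu>': "v \<noteq> y'" "0 < \<mu>'" "x = (1 - \<mu>') *\<^sub>R v + \<mu>' *\<^sub>R y'"
    using assms(9) unfolding in_segment(2) by blast
  have P: "y \<in> P" "y' \<in> P" using assms face_of_imp_subset by blast+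
  have "\<mu> = \<mu>'"
    using wlog[OF assms(2,5,7) P(1) \<mu>(3) \<mu>'(3) \<mu>(1,2)] wlog[OF assms(1,4,6) P(2) \<mu>'(3) \<mu>(3) \<mu>'(1,2)]
    by (metis linorder_cases)
  then have "\<mu> *\<^sub>R y = \<mu> *\<^sub>R y'" using \<mu>(3) \<mu>'(3) by auto
  then show ?thesis using \<mu>(2) by simp
qed

text \<open>Pull a vertex \<open>v\<close>: the ray from \<open>v\<close> through a point of the relative interior leaves \<open>P\<close> in the
  relative interior of a unique face avoiding \<open>v\<close>, which is dissected already.\<close>

lemma polytope_open_triangulation:
  fixes P :: "'a::euclidean_space set"
  assumes "polytope P"
  shows "\<exists>\<T>. finite \<T> \<and>
    (\<forall>\<sigma>\<in>\<T>. \<sigma> \<noteq> {} \<and> \<not> affine_dependent \<sigma> \<and> \<sigma> \<subseteq> {v. v extreme_point_of P}) \<and>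
    disjoint_family_on (\<lambda>\<sigma>. rel_interior (convex hull \<sigma>)) \<T> \<and>
    (\<Union>\<sigma>\<in>\<T>. rel_interior (convex hull \<sigma>)) = rel_interior P"
  using assms
proof (induction "nat (aff_dim P)" arbitrary: P rule: less_induct)
  case less
  let ?ri = "\<lambda>\<sigma> :: 'a set. rel_interior (convex hull \<sigma>)"
  have conv: "convex P" and comp: "compact P"
    using less.prems polytope_imp_convex polytope_imp_compact by auto
  consider "P = {}" | x where "P = {x}" | "aff_dim P > 0"
    by (metis aff_dim_eq_0 aff_dim_negative_iff less_linear)
  then show ?case
  proof cases
    case 1
    then show ?thesis by (intro exI[of _ "{}"]) (auto simp: disjoint_family_on_def)
  next
    case 2
    then show ?thesis by (intro exI[of _ "{{x}}"]) (auto simp: disjoint_family_on_def)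
  next
    case 3
    have "P \<noteq> {}" using 3 by auto
    then obtain v where v: "v extreme_point_of P"
      using extreme_point_exists_convex[OF comp conv] by blast
    then have vP: "v \<in> P" unfolding extreme_point_of_def by blast
    have "P \<noteq> {v}" using 3 by auto
    then have vri: "v \<notin> rel_interior P" using v extreme_point_not_in_REL_INTERIOR by blast
    \<comment> \<open>A face avoiding \<open>v\<close> is proper, so its dimension is smaller and
      the induction hypothesis dissects it.\<close>
    define \<F> where "\<F> = {H. H face_of P \<and> v \<notin> H}"
    have fin\<F>: "finite \<F>"
      using finite_polytope_faces[OF less.prems] unfolding \<F>_def by (rule rev_finite_subset) auto
    define good where "good H \<T> \<longleftrightarrow> finite \<T> \<and>
      (\<forall>\<sigma>\<in>\<T>. \<sigma> \<noteq> {} \<and> \<not> affine_dependent \<sigma> \<and> \<sigma> \<subseteq> {v. v extreme_point_of H}) \<and>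
      disjoint_family_on ?ri \<T> \<and> (\<Union>\<sigma>\<in>\<T>. ?ri \<sigma>) = rel_interior H" for H :: "'a set" and \<T>
    have "\<exists>\<T>. good H \<T>" if H: "H \<in> \<F>" for H
    proof -
      have face: "H face_of P" and "H \<noteq> P" using H vP unfolding \<F>_def by auto
      then have "aff_dim H < aff_dim P" using face_of_aff_dim_lt conv by blast
      then have "nat (aff_dim H) < nat (aff_dim P)" using 3 by auto
      moreover have "polytope H" using face less.prems face_of_polytope_polytope by blast
      ultimately show ?thesis unfolding good_def by (rule less.hyps)
    qed
    then obtain T where T: "\<And>H. H \<in> \<F> \<Longrightarrow> good H (T H)" by metis
    have \<sigma>: "\<sigma> \<noteq> {}" "\<not> affine_dependent \<sigma>" "\<sigma> \<subseteq> {v. v extreme_point_of H}" "\<sigma> \<subseteq> H"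
      "?ri \<sigma> \<subseteq> rel_interior H" if "H \<in> \<F>" "\<sigma> \<in> T H" for H \<sigma>
      using T[OF that(1)] that(2) unfolding good_def extreme_point_of_def by blast+
    have ins: "\<not> affine_dependent (insert v \<sigma>)" "v \<notin> \<sigma>" if "H \<in> \<F>" "\<sigma> \<in> T H" for H \<sigma>
    proof -
      have face: "H face_of P" and vH: "v \<notin> H" using that unfolding \<F>_def by auto
      \<comment> \<open>The exposing hyperplane contains the affine hull of \<open>\<sigma>\<close>
        but not \<open>v\<close>, which makes the cone over \<open>\<sigma>\<close> a genuine
        simplex.\<close>
      then have "H exposed_face_of P"
        using exposed_face_of_polyhedron less.prems polytope_imp_polyhedron by blast
      then obtain a b where ab: "H = P \<inter> {x. a \<bullet> x = b}" unfolding exposed_face_of_def by blast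
      have "affine hull \<sigma> \<subseteq> {x. a \<bullet> x = b}"
        using \<sigma>(4)[OF that] ab by (intro hull_minimal) (auto simp: affine_hyperplane)
      then have "v \<notin> affine hull \<sigma>" using vH vP ab by blast
      then show "\<not> affine_dependent (insert v \<sigma>)" using \<sigma>(2)[OF that] affine_independent_insert by blast
      show "v \<notin> \<sigma>" using \<sigma>(4)[OF that] vH by blast
    qed
    note ri_insert = rel_interior_convex_hull_insert[OF ins \<sigma>(1)]
    \<comment> \<open>The filter is essential: if \<open>H\<close> and \<open>v\<close> lie in a
      common proper face, then the cone over \<open>H\<close> stays in the relative boundary of
      \<open>P\<close> and must be dropped.\<close>
    define \<S> where "\<S> = {insert v \<sigma> |H \<sigma>. H \<in> \<F> \<and> \<sigma> \<in> T H \<and> ?ri (insert v \<sigma>) \<subseteq> rel_interior P}"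
    have "\<S> \<subseteq> (\<Union>H\<in>\<F>. insert v ` T H)" unfolding \<S>_def by blast
    moreover have "finite (\<Union>H\<in>\<F>. insert v ` T H)" using fin\<F> T unfolding good_def by auto
    ultimately have fin: "finite \<S>" by (rule finite_subset)
    have simp: "\<tau> \<noteq> {} \<and> \<not> affine_dependent \<tau> \<and> \<tau> \<subseteq> {v. v extreme_point_of P}" if \<tau>: "\<tau> \<in> \<S>" for \<tau>
    proof -
      obtain H \<sigma> where H: "H \<in> \<F>" "\<sigma> \<in> T H" "\<tau> = insert v \<sigma>" using \<tau> unfolding \<S>_def by blast
      have "w extreme_point_of P" if "w \<in> \<sigma>" for w
        using \<sigma>(3)[OF H(1,2)] that H(1) extreme_point_of_face unfolding \<F>_def by blast
      then show ?thesis using ins(1)[OF H(1,2)] v H(3) by auto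
    qed
    have disj: "disjoint_family_on ?ri \<S>"
      unfolding disjoint_family_on_def
    proof (intro ballI impI)
      fix \<tau> \<tau>' assume "\<tau> \<in> \<S>" "\<tau>' \<in> \<S>" "\<tau> \<noteq> \<tau>'"
      then obtain H \<sigma> H' \<sigma>' where H: "H \<in> \<F>" "\<sigma> \<in> T H" "\<tau> = insert v \<sigma>"
        and H': "H' \<in> \<F>" "\<sigma>' \<in> T H'" "\<tau>' = insert v \<sigma>'" unfolding \<S>_def by blast
      show "?ri \<tau> \<inter> ?ri \<tau>' = {}"
      proof (rule ccontr)
        assume "?ri \<tau> \<inter> ?ri \<tau>' \<noteq> {}"
        then obtain x where x: "x \<in> ?ri (insert v \<sigma>)" "x \<in> ?ri (insert v \<sigma>')" using H(3) H'(3) by blast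
        obtain y where y: "y \<in> ?ri \<sigma>" "x \<in> open_segment v y" using x(1) ri_insert[OF H(1,2) H(1,2) H(1,2)] by blast
        obtain y' where y': "y' \<in> ?ri \<sigma>'" "x \<in> open_segment v y'" using x(2) ri_insert[OF H'(1,2) H'(1,2) H'(1,2)] by blast
        have yH: "y \<in> rel_interior H" "y' \<in> rel_interior H'"
          using y(1) y'(1) \<sigma>(5) H H' by blast+
        have "y = y'"
        proof (rule face_of_ray_unique)
          show "H face_of P" "H' face_of P" "v \<notin> H" "v \<notin> H'" using H(1) H'(1) unfolding \<F>_def by auto
          show "y \<in> H" "y' \<in> H'" using yH rel_interior_subset by blast+
        qed (use vP y y' in auto)
        moreover from this have "H = H'"
          using face_of_eq[of H P H'] yH H(1) H'(1) unfolding \<F>_def by blast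
        ultimately have "\<sigma> = \<sigma>'"
          using T[OF H(1)] H(2) H'(2) y(1) y'(1) unfolding good_def disjoint_family_on_def by blast
        then show False using \<open>\<tau> \<noteq> \<tau>'\<close> H H' by simp
      qed
    qed
    have cover: "\<exists>\<tau>\<in>\<S>. x \<in> ?ri \<tau>" if x: "x \<in> rel_interior P" for x
    proof -
      have xv: "x - v \<noteq> 0" using x vri by auto
      have xP: "x \<in> P" using x rel_interior_subset by blast
      \<comment> \<open>The ray from \<open>x\<close> pointing away from \<open>v\<close> stays in
        the affine hull, so it reaches the relative frontier.\<close>
      have "x + (x - v) \<in> affine hull P"
      proof -
        have "x \<in> affine hull P" "v \<in> affine hull P" using xP vP hull_subset by fast+
        then have "2 *\<^sub>R x + (-1) *\<^sub>R v \<in> affine hull P"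
          by (intro mem_affine[OF affine_affine_hull]) auto
        then show ?thesis by (simp add: algebra_simps scaleR_2)
      qed
      then obtain d where d: "0 < d" "x + d *\<^sub>R (x - v) \<in> rel_frontier P"
        using ray_to_rel_frontier[OF polytope_imp_bounded[OF less.prems] x _ xv] by metis
      define y where "y = x + d *\<^sub>R (x - v)"
      have yP: "y \<in> P" and yri: "y \<notin> rel_interior P"
        using d(2) closure_closed[OF compact_imp_closed[OF comp]] unfolding y_def rel_frontier_def by auto
      have "v \<noteq> y"
      proof
        assume "v = y"
        then have "(1 + d) *\<^sub>R (x - v) = 0" unfolding y_def by (simp add: algebra_simps)
        then show False using xv d(1) by simp
      qed
      moreover have "x = (1 - 1 / (1 + d)) *\<^sub>R v + (1 / (1 + d)) *\<^sub>R y"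
      proof -
        have "(1 + d) *\<^sub>R x = d *\<^sub>R v + y" unfolding y_def by (simp add: algebra_simps)
        then have "(1 / (1 + d)) *\<^sub>R ((1 + d) *\<^sub>R x) = (1 / (1 + d)) *\<^sub>R (d *\<^sub>R v + y)" by simp
        moreover have "d / (1 + d) = 1 - 1 / (1 + d)" using d(1) by (simp add: field_simps)
        ultimately show ?thesis using d(1) by (simp add: scaleR_add_right)
      qed
      moreover have "0 < 1 / (1 + d)" "1 / (1 + d) < 1" using d(1) by auto
      ultimately have seg: "x \<in> open_segment v y" unfolding in_segment(2) by blast
      obtain H where H: "H face_of P" "y \<in> rel_interior H"
        using polytope_in_rel_interior_of_face[OF less.prems yP] by blast
      \<comment> \<open>If \<open>H\<close> contained both \<open>v\<close> and \<open>y\<close>, it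
        would contain the relative interior point \<open>x\<close> and be all of \<open>P\<close>,
        although \<open>y\<close> is on the frontier.\<close>
      have "v \<notin> H"
      proof
        assume "v \<in> H"
        moreover have "y \<in> H" using H(2) rel_interior_subset by blast
        ultimately have "x \<in> H"
          using seg face_of_imp_convex[OF H(1)] convex_contains_open_segment by blast
        then have "H = P" using face_of_disjoint_rel_interior[OF H(1)] x by blast
        then show False using H(2) yri by simp
      qed
      then have H\<F>: "H \<in> \<F>" using H unfolding \<F>_def by blast
      then obtain \<sigma> where s: "\<sigma> \<in> T H" "y \<in> ?ri \<sigma>" using T[of H] H(2) unfolding good_def by blast
      have xri: "x \<in> ?ri (insert v \<sigma>)" using ri_insert[OF H\<F> s(1) H\<F> s(1) H\<F> s(1)] s(2) seg by blast
      have sub: "convex hull (insert v \<sigma>) \<subseteq> P"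
        using \<sigma>(4)[OF H\<F> s(1)] face_of_imp_subset[OF H(1)] vP conv by (intro hull_minimal) auto
      \<comment> \<open>One point \<open>x\<close> of the simplex off the relative frontier suffices
        to place its whole relative interior inside that of \<open>P\<close>.\<close>
      have "?ri (insert v \<sigma>) \<subseteq> rel_interior P"
      proof (rule subset_rel_interior_convex)
        show "convex hull insert v \<sigma> \<subseteq> closure P" using sub closure_subset by blast
        have "x \<in> convex hull insert v \<sigma>" "x \<notin> rel_frontier P"
          using xri rel_interior_subset x unfolding rel_frontier_def by auto
        then show "\<not> convex hull insert v \<sigma> \<subseteq> rel_frontier P" by blast
      qed (use conv in auto)
      then have "insert v \<sigma> \<in> \<S>" unfolding \<S>_def using H\<F> s(1) by blast
      then show ?thesis using xri by blast
    qed
    have "(\<Union>\<tau>\<in>\<S>. ?ri \<tau>) = rel_interior P"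
    proof
      show "(\<Union>\<tau>\<in>\<S>. ?ri \<tau>) \<subseteq> rel_interior P"
      proof (rule UN_least)
        show "?ri \<tau> \<subseteq> rel_interior P" if "\<tau> \<in> \<S>" for \<tau>
          using that unfolding \<S>_def by auto
      qed
      show "rel_interior P \<subseteq> (\<Union>\<tau>\<in>\<S>. ?ri \<tau>)" using cover by auto
    qed
    moreover have "\<forall>\<sigma>\<in>\<S>. \<sigma> \<noteq> {} \<and> \<not> affine_dependent \<sigma> \<and> \<sigma> \<subseteq> {v. v extreme_point_of P}"
      using simp by (rule ballI)
    ultimately show ?thesis using fin disj by (intro exI[of _ \<S>] conjI)
  qed
qed

section \<open>Lattice points of an open lattice simplex\<close>

text \<open>Only the two top powers of x reach degree n in p(x + 1). With p = a + x q one has p(x +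
  1) = a + (x + 1) q(x + 1), which drives the induction. The lemma yields both the degree drop and
  the new leading coefficient of a forward difference.\<close>

lemma coeff_pcompose_shift:
  fixes p :: "'a::idom poly"
  assumes "degree p \<le> Suc n"
  shows "coeff (pcompose p [:1, 1:]) n = coeff p n + of_nat (Suc n) * coeff p (Suc n)"
  using assms
proof (induction p arbitrary: n)
  case 0
  then show ?case by simp
next
  case (pCons a q)
  have deg: "degree q \<le> n" using pCons.prems pCons.hyps by (cases "q = 0") auto
  have lead: "coeff (pcompose q [:1, 1:]) n = coeff q n"
  proof (cases "degree q = n")
    case True
    then show ?thesis using lead_coeff_comp[of "[:1, 1:]" q] by (simp add: degree_pcompose)
  next
    case False
    then show ?thesis using deg by (simp add: coeff_eq_0 degree_pcompose)
  qed
  show ?case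
  proof (cases n)
    case 0
    then show ?thesis using lead by (simp add: pcompose_pCons)
  next
    case (Suc m)
    then have "coeff (pcompose q [:1, 1:]) m = coeff q m + of_nat (Suc m) * coeff q (Suc m)"
      using pCons.IH deg by simp
    then show ?thesis using lead Suc by (simp add: pcompose_pCons algebra_simps)
  qed
qed

text \<open>Pascal's rule turns the sum for \<open>Suc d\<close> into minus the sum for
  \<open>d\<close> of the forward difference \<open>q\<close>. Each difference lowers the degree by
  one and multiplies the top coefficient by the old degree, which produces the factorial.\<close>

lemma binomial_alternating_sum_poly:
  fixes p :: "real poly"
  assumes "degree p \<le> d"
  shows "(\<Sum>k=0..d. (-1) ^ k * real (d choose k) * poly p (real k)) = (-1) ^ d * fact d * coeff p d"
  using assms
proof (induction d arbitrary: p)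
  case 0
  then show ?case by (auto elim!: degree_eq_zeroE)
next
  case (Suc d)
  define q where "q = pcompose p [:1, 1:] - p"
  have cq: "coeff q d = real (Suc d) * coeff p (Suc d)"
    unfolding q_def using coeff_pcompose_shift[OF Suc.prems] by simp
  have dq: "degree q \<le> d"
  proof (rule degree_le, intro allI impI)
    fix i assume "d < i"
    show "coeff q i = 0"
    proof (cases "i = Suc d")
      case True
      then show ?thesis unfolding q_def using coeff_pcompose_shift[of p "Suc d"] Suc.prems
        by (simp add: coeff_eq_0)
    next
      case False
      then show ?thesis unfolding q_def using \<open>d < i\<close> Suc.prems by (simp add: coeff_eq_0 degree_pcompose)
    qed
  qed
  let ?f = "\<lambda>k. poly p (real k)"
  \<comment> \<open>The extra term at \<open>Suc d\<close> is 0, because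
    \<open>d choose Suc d\<close> vanishes; so this is still the sum for \<open>d\<close>.\<close>
  have shift: "(\<Sum>k=0..Suc d. (-1) ^ k * real (d choose k) * ?f k)
      = ?f 0 + (\<Sum>k=0..d. (-1) ^ Suc k * real (d choose Suc k) * ?f (Suc k))"
    by (subst sum.atLeast0_atMost_Suc_shift) simp
  have "(\<Sum>k=0..Suc d. (-1) ^ k * real (Suc d choose k) * ?f k)
      = ?f 0 + (\<Sum>k=0..d. (-1) ^ Suc k * real (Suc d choose Suc k) * ?f (Suc k))"
    by (subst sum.atLeast0_atMost_Suc_shift) simp
  also have "(\<Sum>k=0..d. (-1) ^ Suc k * real (Suc d choose Suc k) * ?f (Suc k))
      = (\<Sum>k=0..d. (-1) ^ Suc k * real (d choose k) * ?f (Suc k)) + (\<Sum>k=0..d. (-1) ^ Suc k * real (d choose Suc k) * ?f (Suc k))"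
    by (simp add: algebra_simps sum.distrib[symmetric])
  also have "?f 0 + \<dots> = (\<Sum>k=0..d. (-1) ^ Suc k * real (d choose k) * ?f (Suc k)) +
      (\<Sum>k=0..Suc d. (-1) ^ k * real (d choose k) * ?f k)"
    unfolding shift by simp
  also have "\<dots> = - (\<Sum>k=0..d. (-1) ^ k * real (d choose k) * poly q (real k))"
    by (simp add: q_def poly_pcompose algebra_simps sum.distrib[symmetric] sum_negf[symmetric])
  also have "\<dots> = (-1) ^ Suc d * fact (Suc d) * coeff p (Suc d)"
    using Suc.IH[OF dq] cq by simp
  finally show ?case .
qed

section \<open>Counting lattice points in dilates\<close>

text \<open>Stars and bars, transferred from lists of fixed length and sum by enumerating
  \<open>S\<close>.\<close>

lemma card_nat_sum_eq:
  assumes "finite S"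
  shows "card {q \<in> S \<rightarrow>\<^sub>E (UNIV::nat set). sum q S = m} = (m + card S - 1) choose m"
proof -
  obtain xs where xs: "distinct xs" "set xs = S" using finite_distinct_list[OF assms] by blast
  have len: "length xs = card S" using xs distinct_card by fastforce
  have "bij_betw (\<lambda>q. map q xs) {q \<in> S \<rightarrow>\<^sub>E (UNIV::nat set). sum q S = m}
     {l. length l = card S \<and> sum_list l = m}"
  proof (rule bij_betwI')
    fix q q' assume "q \<in> {q \<in> S \<rightarrow>\<^sub>E (UNIV::nat set). sum q S = m}" "q' \<in> {q \<in> S \<rightarrow>\<^sub>E (UNIV::nat set). sum q S = m}"
    then show "(map q xs = map q' xs) = (q = q')"
      using xs(2) by (auto intro: PiE_ext)
  next
    fix q assume "q \<in> {q \<in> S \<rightarrow>\<^sub>E (UNIV::nat set). sum q S = m}"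
    then show "map q xs \<in> {l. length l = card S \<and> sum_list l = m}"
      using len xs by (simp add: sum_list_distinct_conv_sum_set)
  next
    fix l assume "l \<in> {l::nat list. length l = card S \<and> sum_list l = m}"
    then have l: "length l = length xs" "sum_list l = m" using len by auto
    define q where "q = restrict (\<lambda>s. the (map_of (zip xs l) s)) S"
    have "map q xs = l"
    proof (rule nth_equalityI)
      show "map q xs ! i = l ! i" if "i < length (map q xs)" for i
      proof -
        have "xs ! i \<in> S" using that xs(2) nth_mem by fastforce
        then show ?thesis using that l xs by (simp add: q_def map_of_zip_nth)
      qed
    qed (use l in simp)
    moreover from this have "sum q S = m"
      using l(2) xs by (metis sum_list_distinct_conv_sum_set)
    moreover have "q \<in> S \<rightarrow>\<^sub>E UNIV" unfolding q_def by auto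
    ultimately show "\<exists>q\<in>{q \<in> S \<rightarrow>\<^sub>E (UNIV::nat set). sum q S = m}. l = map q xs" by blast
  qed
  then show ?thesis using bij_betw_same_card card_length_sum_list by fastforce
qed

text \<open>At \<open>k = 0\<close> the dilate of a nonempty set is the origin alone, so the value
  there is 1 and not that of the counting polynomial. Counting identities are therefore stated for
  \<open>k \<ge> 1\<close>.\<close>

definition lattice_count :: "nat \<Rightarrow> (real^'n) set \<Rightarrow> nat" where
  "lattice_count k A = card {x. lattice_pt x \<and> x \<in> (\<lambda>y. real k *\<^sub>R y) ` A}"

lemma finite_lattice_pt_bounded:
  fixes A :: "(real^'n) set"
  assumes "bounded A"
  shows "finite {x. lattice_pt x \<and> x \<in> A}"
proof -
  obtain B where B: "\<And>x. x \<in> A \<Longrightarrow> norm x \<le> B" using assms bounded_iff by blast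
  let ?Z = "{z::real. z \<in> \<int> \<and> \<bar>z\<bar> \<le> B}"
  have "{x. lattice_pt x \<and> x \<in> A} \<subseteq> (\<lambda>f. \<chi> i. f i) ` (UNIV \<rightarrow>\<^sub>E ?Z)"
  proof
    fix x assume x: "x \<in> {x. lattice_pt x \<and> x \<in> A}"
    have "x $ i \<in> ?Z" for i
      using x B component_le_norm_cart[of x i] unfolding lattice_pt_def by (auto intro: order_trans)
    then have "vec_nth x \<in> UNIV \<rightarrow>\<^sub>E ?Z" by auto
    then show "x \<in> (\<lambda>f. \<chi> i. f i) ` (UNIV \<rightarrow>\<^sub>E ?Z)" by (rule image_eqI[rotated]) (simp add: vec_eq_iff)
  qed
  moreover have "finite (UNIV \<rightarrow>\<^sub>E ?Z :: ('n \<Rightarrow> real) set)"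
    by (intro finite_PiE finite_abs_int_segment) auto
  ultimately show ?thesis using finite_subset by blast
qed

lemma lattice_pt_add: "lattice_pt x \<Longrightarrow> lattice_pt y \<Longrightarrow> lattice_pt (x + y)"
  and lattice_pt_diff: "lattice_pt x \<Longrightarrow> lattice_pt y \<Longrightarrow> lattice_pt (x - y)"
  and lattice_pt_scale: "c \<in> \<int> \<Longrightarrow> lattice_pt x \<Longrightarrow> lattice_pt (c *\<^sub>R x)"
  and lattice_pt_0: "lattice_pt 0"
  unfolding lattice_pt_def by auto

lemma lattice_pt_sum: "(\<And>i. i \<in> I \<Longrightarrow> lattice_pt (f i)) \<Longrightarrow> lattice_pt (\<Sum>i\<in>I. f i)"
  by (induction I rule: infinite_finite_induct) (auto intro: lattice_pt_add lattice_pt_0)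

lemma finite_lattice_count:
  assumes "bounded A"
  shows "finite {x. lattice_pt x \<and> x \<in> (\<lambda>y. real k *\<^sub>R y) ` A}"
  using finite_lattice_pt_bounded[OF bounded_scaling[OF assms]] .

lemma lattice_count_UN:
  assumes fin: "finite I" and bd: "\<And>i. i \<in> I \<Longrightarrow> bounded (A i)" and disj: "disjoint_family_on A I" and k: "k \<noteq> 0"
  shows "lattice_count k (\<Union>i\<in>I. A i) = (\<Sum>i\<in>I. lattice_count k (A i))"
proof -
  have "{x. lattice_pt x \<and> x \<in> (\<lambda>y. real k *\<^sub>R y) ` (\<Union>i\<in>I. A i)} =
     (\<Union>i\<in>I. {x. lattice_pt x \<and> x \<in> (\<lambda>y. real k *\<^sub>R y) ` A i})" by blast
  moreover have "card (\<Union>i\<in>I. {x. lattice_pt x \<and> x \<in> (\<lambda>y. real k *\<^sub>R y) ` A i}) =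
     (\<Sum>i\<in>I. card {x. lattice_pt x \<and> x \<in> (\<lambda>y. real k *\<^sub>R y) ` A i})"
  proof (rule card_UN_disjoint)
    show "\<forall>i\<in>I. \<forall>j\<in>I. i \<noteq> j \<longrightarrow> {x. lattice_pt x \<and> x \<in> (\<lambda>y. real k *\<^sub>R y) ` A i} \<inter>
      {x. lattice_pt x \<and> x \<in> (\<lambda>y. real k *\<^sub>R y) ` A j} = {}"
    proof (intro ballI impI)
      fix i j assume "i \<in> I" "j \<in> I" "i \<noteq> j"
      then have "A i \<inter> A j = {}" using disj unfolding disjoint_family_on_def by blast
      then show "{x. lattice_pt x \<and> x \<in> (\<lambda>y. real k *\<^sub>R y) ` A i} \<inter>
        {x. lattice_pt x \<and> x \<in> (\<lambda>y. real k *\<^sub>R y) ` A j} = {}"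
        using k by auto
    qed
  qed (use fin bd finite_lattice_count in auto)
  ultimately show ?thesis unfolding lattice_count_def by simp
qed

text \<open>Generalized coefficients are used because the polynomial is evaluated at 0 with a
  negative upper entry, where the natural-number binomial gives a different value.\<close>

lemma gbinomial_shift_poly:
  "\<exists>p::real poly. degree p \<le> e \<and> (\<forall>x. poly p x = (x + c) gchoose e)"
proof (intro exI conjI allI)
  let ?p = "smult (1 / fact e) (\<Prod>i=0..<e. [:c - real i, 1:])"
  have "degree (\<Prod>i=0..<e. [:c - real i, 1:]) \<le> (\<Sum>i=0..<e. degree [:c - real i, 1:])"
    using degree_prod_sum_le[of "{0..<e}" "\<lambda>i. [:c - real i, 1:]"] by (simp add: o_def)
  then show "degree ?p \<le> e" by simp
  show "poly ?p x = (x + c) gchoose e" for x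
    by (simp add: gbinomial_prod_rev poly_prod algebra_simps)
qed

text \<open>The numbers \<open>card (R j)\<close> are the numerator coefficients of the Ehrhart
  series of the open simplex: every lattice point of the open cone over it is uniquely a point of
  the half-open box with coordinates in (0, 1] plus a natural combination of vertices. For height
  \<open>k\<close> and box height \<open>j\<close>, stars and bars gives
  \<open>(k + e - j) choose e\<close> combinations.\<close>

lemma lattice_count_open_simplex:
  fixes S :: "(real^'n) set"
  assumes ind: "\<not> affine_dependent S" and ne: "S \<noteq> {}" and lat: "\<And>s. s \<in> S \<Longrightarrow> lattice_pt s"
  shows "\<exists>p::real poly. degree p \<le> card S - 1 \<and> poly p 0 = (- 1) ^ (card S - 1) \<and>
    (\<forall>k\<ge>1. real (lattice_count k (rel_interior (convex hull S))) = poly p (real k))"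
proof -
  define e where "e = card S - 1"
  have fin: "finite S" using ind aff_independent_finite by blast
  have e: "card S = Suc e" unfolding e_def using fin ne by (simp add: card_gt_0_iff)
  define comb where "comb u = (\<Sum>s\<in>S. u s *\<^sub>R s)" for u
  have comb_inj: "u s = u' s" if "sum u S = sum u' S" "comb u = comb u'" "s \<in> S" for u u' s
  proof -
    have "sum (\<lambda>s. u s - u' s) S = 0" "(\<Sum>s\<in>S. (u s - u' s) *\<^sub>R s) = 0"
      using that(1,2) unfolding comb_def by (simp_all add: sum_subtractf scaleR_left_diff_distrib)
    then have "u s - u' s = 0" using ind that(3) unfolding affine_dependent_explicit_finite[OF fin] by blast
    then show ?thesis by simp
  qed
  \<comment> \<open>\<open>U k\<close> holds the barycentric coordinates scaled by \<open>k\<close>.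
    Extensionality makes a function determined by its values on \<open>S\<close>, so
    \<open>comb\<close> is injective on it by affine independence.\<close>
  define U where "U k = {u \<in> extensional S. (\<forall>s\<in>S. 0 < u s) \<and> sum u S = real k \<and> lattice_pt (comb u)}" for k :: nat
  define R where "R j = {r \<in> extensional S. (\<forall>s\<in>S. 0 < r s \<and> r s \<le> 1) \<and> sum r S = real j \<and> lattice_pt (comb r)}" for j :: nat
  define M where "M m = {q \<in> S \<rightarrow>\<^sub>E (UNIV::nat set). sum q S = m}" for m
  have cardM: "card (M m) = (m + e) choose e" for m
    unfolding M_def card_nat_sum_eq[OF fin] e using binomial_symmetric[of e "m + e"] by simp
  have finM: "finite (M m)" for m
  proof -
    have "(m + e) choose e > 0" by simp
    then show ?thesis using cardM card.infinite by (metis less_irrefl)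
  qed
  have countU: "lattice_count k (rel_interior (convex hull S)) = card (U k)" if "k \<ge> 1" for k
  proof -
    have "bij_betw comb (U k) {x. lattice_pt x \<and> x \<in> (\<lambda>y. real k *\<^sub>R y) ` rel_interior (convex hull S)}"
    proof (rule bij_betwI')
      fix u u' assume "u \<in> U k" "u' \<in> U k"
      then show "(comb u = comb u') = (u = u')"
        unfolding U_def using comb_inj by (auto intro!: extensionalityI[of _ S])
    next
      fix u assume u: "u \<in> U k"
      let ?w = "\<lambda>s. u s / real k"
      have "(\<Sum>s\<in>S. ?w s *\<^sub>R s) \<in> rel_interior (convex hull S)"
        unfolding rel_interior_convex_hull_explicit[OF ind] using u that
        by (auto simp: U_def sum_divide_distrib[symmetric] intro!: exI[of _ ?w])
      moreover have "comb u = real k *\<^sub>R (\<Sum>s\<in>S. ?w s *\<^sub>R s)"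
        unfolding comb_def using that by (simp add: scaleR_sum_right)
      ultimately show "comb u \<in> {x. lattice_pt x \<and> x \<in> (\<lambda>y. real k *\<^sub>R y) ` rel_interior (convex hull S)}"
        using u unfolding U_def by blast
    next
      fix x assume "x \<in> {x. lattice_pt x \<and> x \<in> (\<lambda>y. real k *\<^sub>R y) ` rel_interior (convex hull S)}"
      then obtain w where x: "lattice_pt x" "x = real k *\<^sub>R (\<Sum>s\<in>S. w s *\<^sub>R s)" and w: "\<forall>s\<in>S. 0 < w s" "sum w S = 1"
        unfolding rel_interior_convex_hull_explicit[OF ind] by blast
      define u where "u = restrict (\<lambda>s. real k * w s) S"
      have "comb u = x" unfolding comb_def x u_def scaleR_sum_right by (intro sum.cong) auto
      moreover have "u \<in> U k" unfolding U_def using w that x(1) \<open>comb u = x\<close>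
        by (auto simp: u_def sum_distrib_left[symmetric])
      ultimately show "\<exists>u\<in>U k. x = comb u" by blast
    qed
    then show ?thesis unfolding lattice_count_def by (simp add: bij_betw_same_card)
  qed
  have finR: "finite (R j)" for j
  proof -
    have "comb ` R j \<subseteq> {x. lattice_pt x \<and> x \<in> (\<lambda>y. real j *\<^sub>R y) ` (convex hull S)}"
    proof (cases "j = 0")
      case True
      have "R 0 = {}" 
      proof -
        have "sum r S > 0" if "\<forall>s\<in>S. 0 < r s" for r :: "_ \<Rightarrow> real" using that fin ne by (intro sum_pos) auto
        then show ?thesis unfolding R_def by fastforce
      qed
      then show ?thesis using True by simp
    next
      case False
      show ?thesis
      proof clarsimp
        fix r assume r: "r \<in> R j"
        let ?w = "\<lambda>s. r s / real j"
        have "(\<Sum>s\<in>S. ?w s *\<^sub>R s) \<in> convex hull S"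
          unfolding convex_hull_finite[OF fin] using r False
          by (auto simp: R_def sum_divide_distrib[symmetric] less_imp_le intro!: exI[of _ ?w])
        moreover have "comb r = real j *\<^sub>R (\<Sum>s\<in>S. ?w s *\<^sub>R s)"
          unfolding comb_def using False by (simp add: scaleR_sum_right)
        ultimately show "lattice_pt (comb r) \<and> comb r \<in> (*\<^sub>R) (real j) ` (convex hull S)"
          using r unfolding R_def by blast
      qed
    qed
    moreover have "bounded (convex hull S)" using fin by (simp add: finite_imp_bounded bounded_convex_hull)
    ultimately have "finite (comb ` R j)" using finite_lattice_count finite_subset by blast
    moreover have "inj_on comb (R j)"
    proof (rule inj_onI)
      fix r r' assume r: "r \<in> R j" "r' \<in> R j" "comb r = comb r'"
      then have "sum r S = sum r' S" unfolding R_def by simp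
      then have "r s = r' s" if "s \<in> S" for s using comb_inj r(3) that by blast
      then show "r = r'" using r(1,2) unfolding R_def by (auto intro: extensionalityI[of _ S])
    qed
    ultimately show ?thesis using finite_imageD by blast
  qed
  have cardU: "card (U k) = (\<Sum>j=1..Suc e. card (R j) * ((k + e - j) choose e))" if "k \<ge> 1" for k
  proof -
    \<comment> \<open>Cutting off at \<open>k\<close> makes \<open>k - j\<close> an honest
      difference; the missing terms are restored at the end, where they vanish.\<close>
    define J where "J = {1..Suc e} \<inter> {..k}"
    define f where "f = (\<lambda>(j::nat, r, q). restrict (\<lambda>s. r s + real (q s)) S)"
    let ?W = "SIGMA j:J. R j \<times> M (k - j)"
    \<comment> \<open>\<open>\<lceil>u s\<rceil> - 1\<close> is the largest integer strictly below
      \<open>u s\<close>, so the remainder lies in (0, 1]. Rounding with the floor would allow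
      remainder 0 and lose positivity.\<close>
    define q where "q u = restrict (\<lambda>s. nat (\<lceil>u s\<rceil> - 1)) S" for u :: "real^'n \<Rightarrow> real"
    define r where "r u = restrict (\<lambda>s. u s - real (q u s)) S" for u :: "real^'n \<Rightarrow> real"
    define f' where "f' u = (nat \<lfloor>sum (r u) S\<rfloor>, r u, q u)" for u
    have "bij_betw f ?W (U k)"
    proof (rule bij_betw_byWitness[where f' = f'])
      show "\<forall>w\<in>?W. f' (f w) = w"
      proof
        fix w assume w: "w \<in> ?W"
        obtain j r0 q0 where wj: "w = (j, r0, q0)" by (metis prod_cases3)
        have r0: "r0 \<in> R j" and q0: "q0 \<in> M (k - j)" using w wj by auto
        have "nat (\<lceil>r0 s + real (q0 s)\<rceil> - 1) = q0 s" if "s \<in> S" for s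
        proof -
          have "0 < r0 s" "r0 s \<le> 1" using r0 that unfolding R_def by auto
          then have "\<lceil>r0 s + real (q0 s)\<rceil> = int (q0 s) + 1" by linarith
          then show ?thesis by simp
        qed
        then have 1: "q (f w) = q0"
          using q0 unfolding wj f_def M_def q_def by (auto simp: fun_eq_iff PiE_def extensional_def)
        have 2: "r (f w) = r0"
          using r0 unfolding r_def 1 unfolding wj f_def R_def by (auto simp: fun_eq_iff extensional_def)
        have "sum r0 S = real j" using r0 unfolding R_def by simp
        then show "f' (f w) = w" unfolding f'_def 1 2 by (simp add: wj)
      qed
      show "f ` ?W \<subseteq> U k"
      proof (rule image_subsetI)
        fix w assume w: "w \<in> ?W"
        obtain j r0 q0 where wj: "w = (j, r0, q0)" by (metis prod_cases3)
        have j: "j \<in> J" and r0: "r0 \<in> R j" and q0: "q0 \<in> M (k - j)" using w wj by auto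
        have "comb (f w) = comb r0 + (\<Sum>s\<in>S. real (q0 s) *\<^sub>R s)"
          unfolding f_def comb_def wj by (simp add: scaleR_left_distrib sum.distrib)
        moreover have "lattice_pt (\<Sum>s\<in>S. real (q0 s) *\<^sub>R s)"
          by (intro lattice_pt_sum lattice_pt_scale lat) auto
        moreover have "sum (f w) S = real k"
        proof -
          have "sum (f w) S = sum r0 S + real (sum q0 S)" unfolding f_def wj by (simp add: sum.distrib)
          also have "\<dots> = real j + real (k - j)" using r0 q0 unfolding R_def M_def by simp
          finally show ?thesis using j unfolding J_def by simp
        qed
        moreover have "\<forall>s\<in>S. 0 < f w s" using r0 unfolding f_def R_def wj by (auto intro: add_pos_nonneg)
        moreover have "f w \<in> extensional S" unfolding f_def wj by simp
        ultimately show "f w \<in> U k" using r0 unfolding U_def R_def by (simp add: lattice_pt_add)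
      qed
      have q_real: "real (q u s) = real_of_int \<lceil>u s\<rceil> - 1" if "u \<in> U k" "s \<in> S" for u s
      proof -
        have "0 < u s" using that unfolding U_def by simp
        then have "1 \<le> \<lceil>u s\<rceil>" by linarith
        then show ?thesis using that(2) by (simp add: q_def)
      qed
      show "\<forall>u\<in>U k. f (f' u) = u"
        unfolding f'_def f_def r_def U_def by (auto simp: fun_eq_iff extensional_def)
      show "f' ` U k \<subseteq> ?W"
      proof (rule image_subsetI)
        fix u assume u: "u \<in> U k"
        have r01: "0 < r u s \<and> r u s \<le> 1" if "s \<in> S" for s
          using q_real[OF u that] that ceiling_correct[of "u s"] by (simp add: r_def)
        have sumr: "sum (r u) S = real k - real (sum (q u) S)"
          using u unfolding U_def r_def by (simp add: sum_subtractf)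
        have pos: "sum (r u) S > 0" using r01 fin ne by (intro sum_pos) auto
        then have qk: "sum (q u) S < k" using sumr by linarith
        define j where "j = k - sum (q u) S"
        have j: "sum (r u) S = real j" unfolding j_def using sumr qk by simp
        have "sum (r u) S \<le> (\<Sum>s\<in>S. 1)" using r01 by (intro sum_mono) auto
        then have "j \<le> Suc e" using j e by simp
        then have jJ: "j \<in> J" unfolding J_def j_def using qk by auto
        have "comb (r u) = comb u - (\<Sum>s\<in>S. real (q u s) *\<^sub>R s)"
          unfolding comb_def r_def by (simp add: scaleR_left_diff_distrib sum_subtractf)
        moreover have "lattice_pt (\<Sum>s\<in>S. real (q u s) *\<^sub>R s)"
          by (intro lattice_pt_sum lattice_pt_scale lat) auto
        ultimately have "r u \<in> R j" using r01 j u unfolding R_def U_def by (auto simp: r_def intro: lattice_pt_diff)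
        moreover have "q u \<in> M (k - j)" unfolding M_def j_def using qk by (auto simp: q_def)
        moreover have "nat \<lfloor>sum (r u) S\<rfloor> = j" using j by simp
        ultimately show "f' u \<in> ?W" unfolding f'_def using jJ by auto
      qed
    qed
    then have "card (U k) = card ?W" by (simp add: bij_betw_same_card)
    also have "\<dots> = (\<Sum>j\<in>J. card (R j) * ((k - j + e) choose e))"
      using finR finM by (simp add: J_def card_SigmaI card_cartesian_product cardM)
    also have "\<dots> = (\<Sum>j\<in>J. card (R j) * ((k + e - j) choose e))"
      by (intro sum.cong) (auto simp: J_def)
    also have "\<dots> = (\<Sum>j=1..Suc e. card (R j) * ((k + e - j) choose e))"
    proof (rule sum.mono_neutral_left)
      show "\<forall>j\<in>{1..Suc e} - J. card (R j) * ((k + e - j) choose e) = 0"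
      proof
        fix j assume "j \<in> {1..Suc e} - J"
        \<comment> \<open>Here \<open>k < j\<close>. The bound \<open>k \<ge> 1\<close> matters for
          \<open>e = 0\<close>: then \<open>j\<close> is 1, and no such \<open>j\<close> exists
          outside \<open>J\<close>.\<close>
        then have "k + e - j < e" using that unfolding J_def by auto
        then show "card (R j) * ((k + e - j) choose e) = 0" by simp
      qed
    qed (auto simp: J_def)
    finally show ?thesis .
  qed
  \<comment> \<open>\<open>Suc e\<close> numbers, each at most 1, with sum \<open>Suc e\<close> must
    all be 1, and the sum of the vertices is a lattice point.\<close>
  have cardR: "card (R (Suc e)) = 1"
  proof -
    have "R (Suc e) = {restrict (\<lambda>_. 1) S}"
    proof (intro equalityI subsetI)
      fix r assume r: "r \<in> R (Suc e)"
      have "(\<Sum>s\<in>S. 1 - r s) = 0" using r e unfolding R_def by (simp add: sum_subtractf)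
      then have "1 - r s = 0" if "s \<in> S" for s
        using that r fin unfolding R_def by (subst (asm) sum_nonneg_eq_0_iff) auto
      then show "r \<in> {restrict (\<lambda>_. 1) S}" using r unfolding R_def by (auto simp: fun_eq_iff extensional_def)
    next
      fix r :: "real^'n \<Rightarrow> real" assume "r \<in> {restrict (\<lambda>_. 1) S}"
      moreover have "lattice_pt (\<Sum>s\<in>S. s)" using lat by (intro lattice_pt_sum)
      ultimately show "r \<in> R (Suc e)" using e unfolding R_def comb_def by auto
    qed
    then show ?thesis by simp
  qed
  have "\<forall>j::nat. \<exists>p::real poly. degree p \<le> e \<and> (\<forall>x. poly p x = (x + (real e - real j)) gchoose e)"
    using gbinomial_shift_poly by blast
  then obtain b :: "nat \<Rightarrow> real poly" where b: "\<And>j. degree (b j) \<le> e" "\<And>j x. poly (b j) x = (x + (real e - real j)) gchoose e"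
    by metis
  define p where "p = (\<Sum>j=1..Suc e. smult (real (card (R j))) (b j))"
  have "degree p \<le> e" unfolding p_def
    by (intro degree_sum_le) (auto intro: order_trans[OF degree_smult_le] b)
  moreover have "poly p 0 = (- 1) ^ e"
  proof -
    \<comment> \<open>For \<open>1 \<le> j \<le> e\<close> the upper entry \<open>e - j\<close> is a
      natural number below \<open>e\<close>. Only \<open>j = Suc e\<close> survives, with upper
      entry -1 and a single box point; it supplies the sign.\<close>
    have "poly (b j) 0 = 0" if "j \<in> {1..e}" for j
    proof -
      have "poly (b j) 0 = real (e - j) gchoose e" unfolding b using that by (simp add: of_nat_diff)
      also have "\<dots> = real ((e - j) choose e)" by (simp add: binomial_gbinomial)
      also have "\<dots> = 0" using that by simp
      finally show ?thesis .
    qed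
    then have "poly p 0 = poly (b (Suc e)) 0"
      unfolding p_def poly_sum using cardR by simp
    also have "\<dots> = (- 1) gchoose e" unfolding b by simp
    also have "\<dots> = (- 1) ^ e" using gbinomial_minus[of "1::real" e] by (simp flip: binomial_gbinomial)
    finally show ?thesis .
  qed
  moreover have "real (lattice_count k (rel_interior (convex hull S))) = poly p (real k)" if "k \<ge> 1" for k
  proof -
    have "poly (b j) (real k) = real ((k + e - j) choose e)" if "j \<in> {1..Suc e}" for j
    proof -
      \<comment> \<open>With \<open>k \<ge> 1\<close> and \<open>j \<le> Suc e\<close> the natural
        subtraction is exact. At \<open>k = 0\<close>, \<open>j = Suc e\<close> it would truncate,
        which is where count and polynomial part.\<close>
      have "real k + (real e - real j) = real (k + e - j)" using that \<open>k \<ge> 1\<close> by (simp add: of_nat_diff)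
      then show ?thesis unfolding b by (simp add: binomial_gbinomial)
    qed
    then have "poly p (real k) = (\<Sum>j=1..Suc e. real (card (R j)) * real ((k + e - j) choose e))"
      unfolding p_def poly_sum poly_smult by (intro sum.cong) auto
    then show ?thesis unfolding countU[OF that] cardU[OF that] by simp
  qed
  ultimately show ?thesis unfolding e_def by blast
qed

section \<open>Lattice bases and volume\<close>

lemma lattice_basisD:
  assumes "lattice_basis L m b"
  shows "\<And>i. i < m \<Longrightarrow> lattice_pt (b i)"
    and "\<And>t i. (\<Sum>i<m. t i *\<^sub>R b i) = 0 \<Longrightarrow> i < m \<Longrightarrow> t i = 0"
    and "\<And>z. lattice_pt z \<Longrightarrow> z \<in> L \<Longrightarrow> \<exists>c. (\<forall>i<m. c i \<in> \<int>) \<and> z = (\<Sum>i<m. c i *\<^sub>R b i)"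
    and "\<And>c. (\<And>i. i < m \<Longrightarrow> c i \<in> \<int>) \<Longrightarrow> (\<Sum>i<m. c i *\<^sub>R b i) \<in> L"
    and "\<And>i. i < m \<Longrightarrow> b i \<in> L"
proof -
  show "\<And>i. i < m \<Longrightarrow> lattice_pt (b i)"
    and "\<And>t i. (\<Sum>i<m. t i *\<^sub>R b i) = 0 \<Longrightarrow> i < m \<Longrightarrow> t i = 0"
    and "\<And>z. lattice_pt z \<Longrightarrow> z \<in> L \<Longrightarrow> \<exists>c. (\<forall>i<m. c i \<in> \<int>) \<and> z = (\<Sum>i<m. c i *\<^sub>R b i)"
    using assms unfolding lattice_basis_def by blast+
  show L: "\<And>c. (\<And>i. i < m \<Longrightarrow> c i \<in> \<int>) \<Longrightarrow> (\<Sum>i<m. c i *\<^sub>R b i) \<in> L"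
    using assms unfolding lattice_basis_def by blast
  show "b i \<in> L" if "i < m" for i
  proof -
    have "(\<Sum>j<m. (if j = i then 1 else 0) *\<^sub>R b j) = (\<Sum>j<m. if j = i then b j else 0)"
      by (intro sum.cong) auto
    also have "\<dots> = b i" using that by simp
    finally show ?thesis using L[of "\<lambda>j. if j = i then 1 else 0"] by simp
  qed
qed

text \<open>Each generator is a lattice vector, hence an integral combination of the
  \<open>b i\<close>; real combinations follow.\<close>

lemma lattice_basis_span:
  assumes b: "lattice_basis (span B) m b" and lat: "\<And>v. v \<in> B \<Longrightarrow> lattice_pt v" and x: "x \<in> span B"
  shows "\<exists>t. x = (\<Sum>i<m. t i *\<^sub>R b i)"
  using x
proof (induction rule: span_induct_alt)
  case base
  show ?case by (rule exI[of _ "\<lambda>_. 0"]) simp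
next
  case (step c v y)
  obtain t where t: "y = (\<Sum>i<m. t i *\<^sub>R b i)" using step by blast
  obtain s where s: "v = (\<Sum>i<m. s i *\<^sub>R b i)"
    using lattice_basisD(3)[OF b lat[OF step(1)] span_base[OF step(1)]] by blast
  have "c *\<^sub>R v + y = (\<Sum>i<m. (c * s i + t i) *\<^sub>R b i)"
    unfolding s t by (simp add: scaleR_sum_right scaleR_left_distrib sum.distrib)
  then show ?case by (rule exI[of _ "\<lambda>i. c * s i + t i"])
qed

text \<open>Extend a basis of the lattice in \<open>span B\<close> by a lattice vector
  \<open>w\<close> whose height over \<open>span B\<close> is the least positive one. Division with
  remainder then reduces every lattice vector to one in \<open>span B\<close>.\<close>

lemma lattice_basis_exists:
  fixes B :: "(real^'n) set"
  assumes "finite B" "independent B" "\<And>v. v \<in> B \<Longrightarrow> lattice_pt v"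
  shows "\<exists>b. lattice_basis (span B) (card B) b"
  using assms
proof (induction rule: finite_induct)
  case empty
  then show ?case unfolding lattice_basis_def by (auto simp: lattice_pt_0)
next
  case (insert v B)
  define m where "m = card B"
  have indB: "independent B" using insert.prems(1) independent_mono by blast
  obtain b where b: "lattice_basis (span B) m b" using insert.IH indB insert.prems(2) unfolding m_def by auto
  have latv: "lattice_pt v" and latB: "\<And>u. u \<in> B \<Longrightarrow> lattice_pt u" using insert.prems(2) by auto
  obtain \<phi> :: "real^'n \<Rightarrow> real" where \<phi>: "linear \<phi>" "\<And>x. x \<in> insert v B \<Longrightarrow> \<phi> x = (if x = v then 1 else 0)"
    using linear_independent_extend[OF insert.prems(1), of "\<lambda>x. if x = v then 1 else 0"] by blast
  have \<phi>v: "\<phi> v = 1" using \<phi>(2) by simp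
  have \<phi>B: "\<phi> x = 0" if "x \<in> span B" for x
    using \<phi>(1) _ that by (rule linear_eq_0_on_span) (use \<phi>(2) insert.hyps in auto)
  have dec: "x - \<phi> x *\<^sub>R v \<in> span B" if x: "x \<in> span (insert v B)" for x
  proof -
    obtain k where k: "x - k *\<^sub>R v \<in> span B" using x span_breakdown_eq by blast
    then have "\<phi> x = k" using \<phi>B[OF k] \<phi>v by (simp add: linear_diff[OF \<phi>(1)] linear_scale[OF \<phi>(1)])
    then show ?thesis using k by simp
  qed
  have dec0: "x \<in> span B" if "x \<in> span (insert v B)" "\<phi> x = 0" for x using dec[OF that(1)] that(2) by simp
  \<comment> \<open>The bound \<open>d \<le> 1\<close> keeps \<open>D\<close> finite, and the height
    1 of \<open>v\<close> keeps it nonempty, so a minimum exists.\<close>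
  define D where "D = {d. 0 < d \<and> d \<le> 1 \<and> (\<exists>z. lattice_pt z \<and> z \<in> span (insert v B) \<and> \<phi> z = d)}"
  have "1 \<in> D" unfolding D_def using \<phi>v latv span_base[of v "insert v B"] by auto
  define K where "K = norm v + (\<Sum>i<m. norm (b i))"
  have "D \<subseteq> \<phi> ` {z. lattice_pt z \<and> z \<in> cball 0 K}"
  proof
    fix d assume "d \<in> D"
    then obtain z where d: "0 < d" "d \<le> 1" and z: "lattice_pt z" "z \<in> span (insert v B)" "\<phi> z = d" unfolding D_def by blast
    obtain t where t: "z - d *\<^sub>R v = (\<Sum>i<m. t i *\<^sub>R b i)"
      using lattice_basis_span[OF b latB dec[OF z(2)]] z(3) by auto
    \<comment> \<open>Subtracting the integral parts of the coordinates keeps the height and moves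
      \<open>z\<close> into a ball of fixed radius, which contains finitely many lattice
      points.\<close>
    define y where "y = (\<Sum>i<m. of_int \<lfloor>t i\<rfloor> *\<^sub>R b i)"
    have y: "lattice_pt y" "\<phi> y = 0"
    proof -
      show "lattice_pt y" unfolding y_def by (intro lattice_pt_sum lattice_pt_scale lattice_basisD(1)[OF b]) auto
      show "\<phi> y = 0" unfolding y_def by (intro \<phi>B lattice_basisD(4)[OF b]) auto
    qed
    have "z - y = d *\<^sub>R v + (\<Sum>i<m. (t i - of_int \<lfloor>t i\<rfloor>) *\<^sub>R b i)"
      using t unfolding y_def by (simp add: scaleR_left_diff_distrib sum_subtractf algebra_simps)
    also have "norm \<dots> \<le> norm (d *\<^sub>R v) + (\<Sum>i<m. norm ((t i - of_int \<lfloor>t i\<rfloor>) *\<^sub>R b i))"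
      by (intro norm_triangle_le add_left_mono norm_sum)
    also have "\<dots> \<le> K"
      unfolding K_def norm_scaleR
    proof (intro add_mono sum_mono)
      show "\<bar>d\<bar> * norm v \<le> norm v" using d by (simp add: mult_left_le_one_le)
      show "\<bar>t i - of_int \<lfloor>t i\<rfloor>\<bar> * norm (b i) \<le> norm (b i)" for i
      proof (intro mult_left_le_one_le)
        show "\<bar>t i - of_int \<lfloor>t i\<rfloor>\<bar> \<le> 1" by linarith
      qed auto
    qed
    finally have "z - y \<in> cball 0 K" by simp
    moreover have "\<phi> (z - y) = d" using z y by (simp add: linear_diff[OF \<phi>(1)])
    ultimately show "d \<in> \<phi> ` {z. lattice_pt z \<and> z \<in> cball 0 K}" using lattice_pt_diff[OF z(1) y(1)] by blast
  qed
  then have finD: "finite D" using finite_lattice_pt_bounded[of "cball 0 K"] finite_subset by blast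
  define \<delta> where "\<delta> = Min D"
  have "\<delta> \<in> D" unfolding \<delta>_def using finD \<open>1 \<in> D\<close> by (intro Min_in) auto
  then obtain w where w: "lattice_pt w" "w \<in> span (insert v B)" "\<phi> w = \<delta>" and \<delta>: "0 < \<delta>" "\<delta> \<le> 1"
    unfolding D_def by blast
  define b' where "b' = b(m := w)"
  have sum': "(\<Sum>i<Suc m. t i *\<^sub>R b' i) = (\<Sum>i<m. t i *\<^sub>R b i) + t m *\<^sub>R w" for t
    unfolding b'_def by simp
  have \<phi>sum: "\<phi> (\<Sum>i<m. t i *\<^sub>R b i) = 0" for t
    by (intro \<phi>B span_sum span_scale lattice_basisD(5)[OF b]) auto
  have "lattice_basis (span (insert v B)) (Suc m) b'"
    unfolding lattice_basis_def
  proof (intro conjI allI impI iffI)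
    show "lattice_pt (b' i)" if "i < Suc m" for i
      using that lattice_basisD(1)[OF b] w(1) unfolding b'_def by (auto simp: less_Suc_eq)
    show "t i = 0" if t0: "(\<Sum>i<Suc m. t i *\<^sub>R b' i) = 0" and i: "i < Suc m" for t i
    proof -
      have "\<phi> ((\<Sum>i<m. t i *\<^sub>R b i) + t m *\<^sub>R w) = 0" using t0 linear_0[OF \<phi>(1)] unfolding sum' by simp
      then have "t m * \<delta> = 0" using \<phi>sum[of t] w(3) by (simp add: linear_add[OF \<phi>(1)] linear_scale[OF \<phi>(1)])
      then have tm: "t m = 0" using \<delta> by simp
      then have "(\<Sum>i<m. t i *\<^sub>R b i) = 0" using t0 unfolding sum' by simp
      then show ?thesis using lattice_basisD(2)[OF b] tm i less_Suc_eq by metis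
    qed
    show "\<exists>c. (\<forall>i<Suc m. c i \<in> \<int>) \<and> z = (\<Sum>i<Suc m. c i *\<^sub>R b' i)" if z: "lattice_pt z \<and> z \<in> span (insert v B)" for z
    proof -
      \<comment> \<open>The remainder \<open>\<phi> z - q * \<delta>\<close> is the height of a
        lattice vector and is smaller than the minimum \<open>\<delta>\<close>; hence it is
        0.\<close>
      define q where "q = real_of_int \<lfloor>\<phi> z / \<delta>\<rfloor>"
      have q: "q \<in> \<int>" unfolding q_def by simp
      have lat: "lattice_pt (z - q *\<^sub>R w)" using z w q by (intro lattice_pt_diff lattice_pt_scale) auto
      have sp: "z - q *\<^sub>R w \<in> span (insert v B)" using z w by (intro span_diff span_scale) auto
      have val: "\<phi> (z - q *\<^sub>R w) = \<phi> z - q * \<delta>" using w(3) by (simp add: linear_diff[OF \<phi>(1)] linear_scale[OF \<phi>(1)])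
      have "q \<le> \<phi> z / \<delta>" "\<phi> z / \<delta> < q + 1" unfolding q_def by linarith+
      then have rng: "0 \<le> \<phi> z - q * \<delta>" "\<phi> z - q * \<delta> < \<delta>" using \<delta> by (simp_all add: field_simps)
      have "\<phi> (z - q *\<^sub>R w) = 0"
      proof (rule ccontr)
        assume "\<phi> (z - q *\<^sub>R w) \<noteq> 0"
        then have "\<phi> z - q * \<delta> \<in> D" unfolding D_def using rng val \<delta> lat sp by auto
        then have "\<delta> \<le> \<phi> z - q * \<delta>" unfolding \<delta>_def using finD by simp
        then show False using rng by simp
      qed
      then have "z - q *\<^sub>R w \<in> span B" using dec0 sp by blast
      then obtain c where c: "\<forall>i<m. c i \<in> \<int>" "z - q *\<^sub>R w = (\<Sum>i<m. c i *\<^sub>R b i)"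
        using lattice_basisD(3)[OF b lat] by blast
      have "z = (\<Sum>i<Suc m. (c(m := q)) i *\<^sub>R b' i)" unfolding sum' using c(2) by (simp add: algebra_simps)
      moreover have "\<forall>i<Suc m. (c(m := q)) i \<in> \<int>" using c(1) q by (auto simp: less_Suc_eq)
      ultimately show ?thesis by blast
    qed
    show "lattice_pt z" if ex: "\<exists>c. (\<forall>i<Suc m. c i \<in> \<int>) \<and> z = (\<Sum>i<Suc m. c i *\<^sub>R b' i)" for z
    proof -
      from ex obtain c where c: "\<forall>i<Suc m. c i \<in> \<int>" "z = (\<Sum>i<Suc m. c i *\<^sub>R b' i)" by (elim exE conjE)
      note c = c(1) c(2)[unfolded sum']
      show ?thesis unfolding c(2)
        by (intro lattice_pt_add lattice_pt_sum lattice_pt_scale lattice_basisD(1)[OF b] w(1)) (use c(1) in auto)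
    qed
    show "z \<in> span (insert v B)" if ex: "\<exists>c. (\<forall>i<Suc m. c i \<in> \<int>) \<and> z = (\<Sum>i<Suc m. c i *\<^sub>R b' i)" for z
    proof -
      from ex obtain c where "z = (\<Sum>i<Suc m. c i *\<^sub>R b' i)" by (elim exE conjE)
      note c = this[unfolded sum']
      have "b i \<in> span (insert v B)" if "i < m" for i
        using lattice_basisD(5)[OF b that] span_mono[of B "insert v B"] by blast
      then show ?thesis unfolding c by (intro span_add span_sum span_scale w(2)) auto
    qed
  qed
  then show ?case using insert.hyps unfolding m_def by auto
qed

text \<open>These coordinate functionals give uniqueness of coordinates and bound the coordinates of
  a bounded set.\<close>

lemma lattice_basis_dual:
  assumes b: "lattice_basis L m b"
  obtains \<psi> :: "nat \<Rightarrow> real^'n \<Rightarrow> real" where "\<And>i. i < m \<Longrightarrow> linear (\<psi> i)"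
    and "\<And>i t. i < m \<Longrightarrow> \<psi> i (\<Sum>j<m. t j *\<^sub>R b j) = t i"
proof -
  have inj: "inj_on b {..<m}"
  proof (rule inj_onI, rule ccontr)
    fix i j assume ij: "i \<in> {..<m}" "j \<in> {..<m}" "b i = b j" "i \<noteq> j"
    have "(\<Sum>k<m. ((if k = i then 1 else 0) - (if k = j then 1 else 0)) *\<^sub>R b k) =
       (\<Sum>k<m. if k = i then b k else 0) - (\<Sum>k<m. if k = j then b k else 0)"
      unfolding sum_subtractf[symmetric] by (intro sum.cong) auto
    also have "\<dots> = 0" using ij by simp
    finally show False using lattice_basisD(2)[OF b, of "\<lambda>k. (if k = i then 1 else 0) - (if k = j then 1 else 0)" i] ij by auto
  qed
  have ind: "independent (b ` {..<m})"
  proof (rule independent_if_scalars_zero)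
    fix f x assume f: "(\<Sum>x\<in>b ` {..<m}. f x *\<^sub>R x) = 0" and x: "x \<in> b ` {..<m}"
    obtain i where i: "i < m" "x = b i" using x by auto
    have "(\<Sum>i<m. f (b i) *\<^sub>R b i) = 0" using f sum.reindex[OF inj, of "\<lambda>x. f x *\<^sub>R x"] by (simp add: o_def)
    then show "f x = 0" using lattice_basisD(2)[OF b] i by metis
  qed simp
  have "\<exists>\<psi>. linear \<psi> \<and> (\<forall>j<m. \<psi> (b j) = (if j = i then 1 else 0 :: real))" if i: "i < m" for i
  proof -
    obtain \<psi> where \<psi>: "linear \<psi>" "\<forall>x\<in>b ` {..<m}. \<psi> x = (if x = b i then 1 else 0 :: real)"
      using linear_independent_extend[OF ind, of "\<lambda>x. if x = b i then 1 else 0 :: real"] by blast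
    have "\<psi> (b j) = (if j = i then 1 else 0)" if "j < m" for j
      using \<psi>(2) that i inj by (auto simp: inj_on_def)
    then show ?thesis using \<psi>(1) by blast
  qed
  then obtain \<psi> where \<psi>: "\<And>i. i < m \<Longrightarrow> linear (\<psi> i)"
     "\<And>i j. i < m \<Longrightarrow> j < m \<Longrightarrow> \<psi> i (b j) = (if j = i then 1 else 0 :: real)" by metis
  show ?thesis
  proof (rule that[of \<psi>])
    show "linear (\<psi> i)" if "i < m" for i using \<psi>(1) that .
    show "\<psi> i (\<Sum>j<m. t j *\<^sub>R b j) = t i" if i: "i < m" for i t
    proof -
      have "\<psi> i (\<Sum>j<m. t j *\<^sub>R b j) = (\<Sum>j<m. t j * \<psi> i (b j))"
        by (simp add: linear_sum[OF \<psi>(1)[OF i]] linear_scale[OF \<psi>(1)[OF i]])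
      also have "\<dots> = (\<Sum>j<m. if j = i then t j else 0)" using \<psi>(2)[OF i] by (intro sum.cong) auto
      finally show ?thesis using i by simp
    qed
  qed
qed

text \<open>Differences between the vertices and one fixed vertex span the direction space, and a
  basis can be chosen among them. It consists of lattice vectors, so
  \<open>lattice_basis_exists\<close> applies.\<close>

lemma parallel_space_lattice_polytope:
  fixes F :: "(real^'n) set"
  assumes F: "polytope F" "F \<noteq> {}" and lat: "\<And>v. v extreme_point_of F \<Longrightarrow> lattice_pt v"
  obtains B v where "finite B" "independent B" "\<And>u. u \<in> B \<Longrightarrow> lattice_pt u" "int (card B) = aff_dim F"
    "parallel_space F = span B" "v \<in> F" "lattice_pt v" "affine hull F = (+) v ` span B"
proof -
  let ?V = "{v. v extreme_point_of F}"
  have FV: "F = convex hull ?V"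
    using Krein_Milman_Minkowski[OF polytope_imp_compact[OF F(1)] polytope_imp_convex[OF F(1)]] .
  then have "?V \<noteq> {}" using F(2) by auto
  then obtain v where v: "v \<in> ?V" by blast
  let ?W = "(+) (- v) ` ?V"
  obtain B where B: "B \<subseteq> ?W" "independent B" "?W \<subseteq> span B" "card B = dim ?W"
    using basis_exists by blast
  have spB: "span B = span ?W" using B by (metis span_mono span_span subset_antisym span_minimal subspace_span)
  have affF: "affine hull F = affine hull ?V" using FV by (metis affine_hull_convex_hull)
  have aff: "affine hull F = (+) v ` span B"
  proof -
    have "?W = insert 0 ((+) (- v) ` (?V - {v}))" using v by force
    then have "span ?W = span ((+) (- v) ` (?V - {v}))" by (simp only: span_insert_0)
    then show ?thesis unfolding affF spB using affine_hull_span2[of v ?V] v by simp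
  qed
  have vF: "v \<in> F" using v unfolding extreme_point_of_def by blast
  have VF: "?V \<subseteq> F" unfolding extreme_point_of_def by blast
  have "parallel_space F = span B"
  proof
    show "parallel_space F \<subseteq> span B"
      unfolding parallel_space_def
    proof (rule span_minimal)
      show "(\<lambda>(x, y). x - y) ` (F \<times> F) \<subseteq> span B"
      proof clarify
        fix x y assume "x \<in> F" "y \<in> F"
        then obtain x' y' where "x = v + x'" "y = v + y'" "x' \<in> span B" "y' \<in> span B"
          using aff hull_subset[of F affine] by blast
        then show "x - y \<in> span B" using span_diff[of x' B y'] by simp
      qed
    qed simp
    have "?W \<subseteq> (\<lambda>(x, y). x - y) ` (F \<times> F)"
    proof clarify
      fix x assume "x extreme_point_of F"
      then show "- v + x \<in> (\<lambda>(x, y). x - y) ` (F \<times> F)" using VF vF by (auto intro!: image_eqI[of _ _ "(x, v)"])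
    qed
    then show "span B \<subseteq> parallel_space F" unfolding spB parallel_space_def by (rule span_mono)
  qed
  moreover have "int (card B) = aff_dim F"
  proof -
    have "aff_dim F = aff_dim ?V" using affF by (metis aff_dim_affine_hull)
    also have "\<dots> = int (dim ?W)" by (rule aff_dim_eq_dim[OF hull_inc[OF v]])
    finally show ?thesis using B(4) by simp
  qed
  moreover have "lattice_pt u" if "u \<in> B" for u
    using that B(1) lat lattice_pt_diff v by fastforce
  ultimately show ?thesis using that[of B v] B(2) independent_imp_finite aff vF lat v by blast
qed

section \<open>Normalized volume as a limit of lattice point counts\<close>

text \<open>Fubini, integrating first over the coordinate with nonzero coefficient: each fibre has
  at most one point.\<close>

lemma PiM_lborel_hyperplane_null:
  fixes \<alpha> :: "'i \<Rightarrow> real"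
  assumes fin: "finite I" and i: "i \<in> I" "\<alpha> i \<noteq> 0"
  shows "{x \<in> space (PiM I (\<lambda>_. lborel)). (\<Sum>j\<in>I. \<alpha> j * x j) = \<beta>} \<in> null_sets (PiM I (\<lambda>_. lborel))"
proof -
  interpret product_sigma_finite "\<lambda>_::'i. lborel :: real measure" by standard
  let ?M = "PiM I (\<lambda>_. lborel :: real measure)"
  let ?N = "{x \<in> space ?M. (\<Sum>j\<in>I. \<alpha> j * x j) = \<beta>}"
  define J where "J = I - {i}"
  have J: "finite J" "i \<notin> J" "I = insert i J" unfolding J_def using fin i by auto
  have meas: "?N \<in> sets ?M" by measurable
  have "emeasure ?M ?N = (\<integral>\<^sup>+x. indicator ?N x \<partial>?M)" using meas by simp
  also have "\<dots> = (\<integral>\<^sup>+x. (\<integral>\<^sup>+y. indicator ?N (x(i := y)) \<partial>lborel) \<partial>PiM J (\<lambda>_. lborel))"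
    using product_nn_integral_insert[OF J(1,2), of "indicator ?N"] meas unfolding J(3) by simp
  also have "\<dots> = (\<integral>\<^sup>+x. 0 \<partial>PiM J (\<lambda>_. lborel :: real measure))"
  proof (intro nn_integral_cong)
    fix x :: "'i \<Rightarrow> real"
    let ?c = "(\<beta> - (\<Sum>j\<in>J. \<alpha> j * x j)) / \<alpha> i"
    have eq: "(\<Sum>j\<in>I. \<alpha> j * (x(i := y)) j) = \<alpha> i * y + (\<Sum>j\<in>J. \<alpha> j * x j)" for y
      unfolding J(3) using J(1,2) by (simp add: sum.insert) (intro sum.cong, auto)
    have "indicator ?N (x(i := y)) \<le> (indicator {?c} y :: ennreal)" for y
      using i(2) eq[of y] by (auto simp: indicator_def field_simps)
    then have "(\<integral>\<^sup>+y. indicator ?N (x(i := y)) \<partial>lborel) \<le> (\<integral>\<^sup>+y. indicator {?c} y \<partial>lborel)"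
      by (intro nn_integral_mono) auto
    also have "\<dots> = 0" by simp
    finally show "(\<integral>\<^sup>+y. indicator ?N (x(i := y)) \<partial>lborel) = 0" by simp
  qed
  finally show ?thesis using meas by (simp add: null_sets_def)
qed

text \<open>A Riemann sum argument: in the coordinates of \<open>b\<close>, the lattice points of
  the dilate become points of a grid of mesh \<open>1 / Suc k\<close>, each carrying one half-open
  box. The union of these boxes converges to the coordinate body off its bounding hyperplanes, and
  dominated convergence applies.\<close>

lemma lattice_count_tendsto_volume:
  fixes F :: "(real^'n) set"
  assumes F: "polytope F" "F \<noteq> {}" and lat: "\<And>v. v extreme_point_of F \<Longrightarrow> lattice_pt v"
    and b: "lattice_basis (parallel_space F) m b" and p: "p \<in> F"
  shows "(\<lambda>k. real (lattice_count (Suc k) F) / real (Suc k) ^ m) \<longlonglongrightarrow>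
    measure (PiM {..<m} (\<lambda>_. lborel)) {t \<in> space (PiM {..<m} (\<lambda>_. lborel)). p + (\<Sum>i<m. t i *\<^sub>R b i) \<in> F}"
proof -
  obtain B v where latB: "\<And>u. u \<in> B \<Longrightarrow> lattice_pt u" and par: "parallel_space F = span B"
    and v: "v \<in> F" "lattice_pt v" and aff: "affine hull F = (+) v ` span B"
    using parallel_space_lattice_polytope[OF F lat] by metis
  note b = b[unfolded par]
  have bB: "(\<Sum>i<m. t i *\<^sub>R b i) \<in> span B" for t
    by (intro span_sum span_scale lattice_basisD(5)[OF b]) auto
  have affD: "x - v \<in> span B" if "x \<in> affine hull F" for x using that aff by auto
  have F_aff: "x - v \<in> span B" if "x \<in> F" for x using affD hull_inc[OF that] by blast
  \<comment> \<open>The base point \<open>p\<close> is arbitrary, while the grid must be anchored at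
    the lattice point \<open>v\<close>; \<open>\<tau>\<close> is the offset between the two.\<close>
  obtain \<tau> where \<tau>: "p - v = (\<Sum>i<m. \<tau> i *\<^sub>R b i)"
    using lattice_basis_span[OF b latB F_aff[OF p]] by blast
  obtain \<psi> :: "nat \<Rightarrow> real^'n \<Rightarrow> real" where \<psi>: "\<And>i. i < m \<Longrightarrow> linear (\<psi> i)"
    "\<And>i t. i < m \<Longrightarrow> \<psi> i (\<Sum>j<m. t j *\<^sub>R b j) = t i"
    using lattice_basis_dual[OF b] by blast
  define E where "E t = p + (\<Sum>i<m. t i *\<^sub>R b i)" for t
  have Ev: "E (\<lambda>i. s i - \<tau> i) = v + (\<Sum>i<m. s i *\<^sub>R b i)" for s
    using \<tau> unfolding E_def by (simp add: scaleR_left_diff_distrib sum_subtractf algebra_simps)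
  have Eaff: "E t \<in> affine hull F" for t
    unfolding aff E_def using span_add[OF F_aff[OF p] bB[of t]] by (auto intro!: image_eqI[of _ _ "p - v + (\<Sum>i<m. t i *\<^sub>R b i)"])
  \<comment> \<open>This form of the halfspace representation has normals parallel to the affine
    hull, so none of the inequalities degenerates in the coordinates of \<open>b\<close>.\<close>
  obtain H where H: "finite H" "F = affine hull F \<inter> \<Inter>H"
    "\<And>h. h \<in> H \<Longrightarrow> \<exists>a \<beta>. a \<noteq> 0 \<and> h = {x. a \<bullet> x \<le> \<beta>} \<and> (\<forall>x\<in>affine hull F. x + a \<in> affine hull F)"
    using polytope_imp_polyhedron[OF F(1)] unfolding polyhedron_Int_affine_parallel by metis
  obtain a \<beta> where a: "\<And>h. h \<in> H \<Longrightarrow> a h \<noteq> 0" "\<And>h. h \<in> H \<Longrightarrow> h = {x. a h \<bullet> x \<le> \<beta> h}"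
    "\<And>h x. h \<in> H \<Longrightarrow> x \<in> affine hull F \<Longrightarrow> x + a h \<in> affine hull F"
    using H(3) by metis
  have EF: "E t \<in> F \<longleftrightarrow> (\<forall>h\<in>H. a h \<bullet> E t \<le> \<beta> h)" for t
  proof -
    have "E t \<in> F \<longleftrightarrow> (\<forall>h\<in>H. E t \<in> h)" using H(2) Eaff[of t] by blast
    also have "\<dots> \<longleftrightarrow> (\<forall>h\<in>H. a h \<bullet> E t \<le> \<beta> h)" using a(2) by (intro ball_cong) auto
    finally show ?thesis .
  qed
  define \<alpha> where "\<alpha> h i = a h \<bullet> b i" for h i
  have aE: "a h \<bullet> E t = a h \<bullet> p + (\<Sum>i<m. \<alpha> h i * t i)" for h t
    unfolding E_def \<alpha>_def by (simp add: inner_add_right inner_sum_right mult.commute)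
  let ?M = "PiM {..<m} (\<lambda>_. lborel :: real measure)"
  interpret product_sigma_finite "\<lambda>_::nat. lborel :: real measure" by standard
  define N where "N h = {x \<in> space ?M. (\<Sum>i<m. \<alpha> h i * x i) = \<beta> h - a h \<bullet> p}" for h
  have N: "N h \<in> null_sets ?M" if h: "h \<in> H" for h
  proof -
    have "(v + a h) - v \<in> span B" using a(3)[OF h hull_inc[OF v(1)]] by (rule affD)
    then obtain s where s: "a h = (\<Sum>i<m. s i *\<^sub>R b i)" using lattice_basis_span[OF b latB] by auto
    \<comment> \<open>Otherwise \<open>a h\<close> would be orthogonal to all \<open>b i\<close>, of
      which it is itself a combination, and hence zero.\<close>
    have "\<exists>i<m. \<alpha> h i \<noteq> 0"
    proof (rule ccontr)
      assume "\<not> ?thesis"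
      then have "a h \<bullet> (\<Sum>i<m. s i *\<^sub>R b i) = 0" unfolding inner_sum_right \<alpha>_def by simp
      then show False using a(1)[OF h] s by simp
    qed
    then show ?thesis unfolding N_def by (auto intro!: PiM_lborel_hyperplane_null)
  qed
  define T where "T = {t \<in> space ?M. E t \<in> F}"
  have T: "T \<in> sets ?M"
  proof -
    have "{t \<in> space ?M. a h \<bullet> p + (\<Sum>i<m. \<alpha> h i * t i) \<le> \<beta> h} \<in> sets ?M" for h by measurable
    then show ?thesis unfolding T_def EF aE using H(1) by (intro sets.sets_Collect_finite_All) auto
  qed
  \<comment> \<open>Rounding down to the grid turns the normalized count into the measure of \<open>A k\<close> below.\<close>
  define g where "g k x i = of_int \<lfloor>real (Suc k) * (x i + \<tau> i)\<rfloor> / real (Suc k) - \<tau> i" for k x i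
  have g_le: "\<bar>g k x i - x i\<bar> \<le> inverse (real (Suc k))" for k x i
  proof -
    let ?y = "real (Suc k) * (x i + \<tau> i)"
    have "g k x i - x i = (of_int \<lfloor>?y\<rfloor> - ?y) * inverse (real (Suc k))"
      unfolding g_def by (simp add: field_simps)
    moreover have "\<bar>of_int \<lfloor>?y\<rfloor> - ?y\<bar> \<le> 1" by linarith
    ultimately show ?thesis by (simp add: abs_mult mult_left_le_one_le)
  qed
  have g_lim: "(\<lambda>k. g k x i) \<longlonglongrightarrow> x i" for x i
  proof -
    have "(\<lambda>k. g k x i - x i) \<longlonglongrightarrow> 0"
      by (rule Lim_null_comparison[OF _ LIMSEQ_inverse_real_of_nat]) (use g_le in \<open>simp del: of_nat_Suc\<close>)
    then show ?thesis by (simp add: LIM_zero_iff)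
  qed
  define A where "A k = {x \<in> space ?M. E (g k x) \<in> F}" for k
  define Z where "Z k = {c \<in> {..<m} \<rightarrow>\<^sub>E (UNIV::int set). E (\<lambda>i. of_int (c i) / real (Suc k) - \<tau> i) \<in> F}" for k
  define Box where "Box k c = (\<Pi>\<^sub>E i\<in>{..<m}. {of_int (c i) / real (Suc k) - \<tau> i ..< (of_int (c i) + 1) / real (Suc k) - \<tau> i})"
    for k and c :: "nat \<Rightarrow> int"
  have bij: "bij_betw (\<lambda>c. real (Suc k) *\<^sub>R v + (\<Sum>i<m. of_int (c i) *\<^sub>R b i)) (Z k)
     {x. lattice_pt x \<and> x \<in> (\<lambda>y. real (Suc k) *\<^sub>R y) ` F}" for k
  proof (rule bij_betwI')
    fix c c' assume c: "c \<in> Z k" "c' \<in> Z k"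
    show "(real (Suc k) *\<^sub>R v + (\<Sum>i<m. of_int (c i) *\<^sub>R b i) = real (Suc k) *\<^sub>R v + (\<Sum>i<m. of_int (c' i) *\<^sub>R b i)) = (c = c')"
    proof
      assume "real (Suc k) *\<^sub>R v + (\<Sum>i<m. of_int (c i) *\<^sub>R b i) = real (Suc k) *\<^sub>R v + (\<Sum>i<m. of_int (c' i) *\<^sub>R b i)"
      then have eq: "(\<Sum>i<m. real_of_int (c i) *\<^sub>R b i) = (\<Sum>i<m. real_of_int (c' i) *\<^sub>R b i)" by simp
      have "c i = c' i" if "i < m" for i
        using \<psi>(2)[OF that, of "\<lambda>i. real_of_int (c i)"] \<psi>(2)[OF that, of "\<lambda>i. real_of_int (c' i)"] eq by simp
      then show "c = c'" using c unfolding Z_def by (auto intro!: PiE_ext[of c "{..<m}" _ c'])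
    qed simp
  next
    fix c assume c: "c \<in> Z k"
    let ?y = "v + (\<Sum>i<m. (of_int (c i) / real (Suc k)) *\<^sub>R b i)"
    have "?y \<in> F" using c unfolding Z_def Ev by simp
    moreover have "real (Suc k) *\<^sub>R v + (\<Sum>i<m. of_int (c i) *\<^sub>R b i) = real (Suc k) *\<^sub>R ?y"
      by (simp add: scaleR_add_right scaleR_sum_right del: of_nat_Suc)
    moreover have "lattice_pt (real (Suc k) *\<^sub>R v + (\<Sum>i<m. of_int (c i) *\<^sub>R b i))"
      by (intro lattice_pt_add lattice_pt_sum lattice_pt_scale v lattice_basisD(1)[OF b]) auto
    ultimately show "real (Suc k) *\<^sub>R v + (\<Sum>i<m. of_int (c i) *\<^sub>R b i) \<in> {x. lattice_pt x \<and> x \<in> (\<lambda>y. real (Suc k) *\<^sub>R y) ` F}"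
      by blast
  next
    fix x assume "x \<in> {x. lattice_pt x \<and> x \<in> (\<lambda>y. real (Suc k) *\<^sub>R y) ` F}"
    then obtain y where x: "lattice_pt x" "x = real (Suc k) *\<^sub>R y" "y \<in> F" by blast
    have "lattice_pt (x - real (Suc k) *\<^sub>R v)" using x(1) v(2) by (intro lattice_pt_diff lattice_pt_scale) auto
    moreover have "x - real (Suc k) *\<^sub>R v \<in> span B"
      using span_scale[OF F_aff[OF x(3)], of "real (Suc k)"] unfolding x(2) by (simp add: scaleR_diff_right del: of_nat_Suc)
    ultimately obtain c where c: "\<forall>i<m. c i \<in> \<int>" "x - real (Suc k) *\<^sub>R v = (\<Sum>i<m. c i *\<^sub>R b i)"
      using lattice_basisD(3)[OF b] by blast
    define d where "d = restrict (\<lambda>i. \<lfloor>c i\<rfloor>) {..<m}"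
    have d: "real_of_int (d i) = c i" if "i < m" for i using c(1) that unfolding d_def by auto
    have xd: "x = real (Suc k) *\<^sub>R v + (\<Sum>i<m. of_int (d i) *\<^sub>R b i)"
      using c(2) d by (simp add: algebra_simps del: of_nat_Suc)
    have "real (Suc k) *\<^sub>R y = real (Suc k) *\<^sub>R (v + (\<Sum>i<m. (of_int (d i) / real (Suc k)) *\<^sub>R b i))"
      using xd x(2) by (simp add: scaleR_add_right scaleR_sum_right del: of_nat_Suc)
    then have "y = v + (\<Sum>i<m. (of_int (d i) / real (Suc k)) *\<^sub>R b i)" by (simp del: of_nat_Suc)
    then have "d \<in> Z k" using x(3) unfolding Z_def Ev by (auto simp: d_def)
    then show "\<exists>c\<in>Z k. x = real (Suc k) *\<^sub>R v + (\<Sum>i<m. of_int (c i) *\<^sub>R b i)" using xd by blast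
  qed
  have cardZ: "card (Z k) = lattice_count (Suc k) F" for k
    unfolding lattice_count_def using bij_betw_same_card[OF bij] .
  have finZ: "finite (Z k)" for k
    using bij_betw_finite[OF bij] finite_lattice_count[OF polytope_imp_bounded[OF F(1)]] by blast
  have Box_iff: "x \<in> Box k c \<longleftrightarrow> (\<forall>i<m. \<lfloor>real (Suc k) * (x i + \<tau> i)\<rfloor> = c i)" if "x \<in> space ?M" for x k c
  proof -
    have "(of_int (c i) / real (Suc k) - \<tau> i \<le> x i \<and> x i < (of_int (c i) + 1) / real (Suc k) - \<tau> i) \<longleftrightarrow>
       \<lfloor>real (Suc k) * (x i + \<tau> i)\<rfloor> = c i" for i
      unfolding floor_eq_iff by (auto simp: field_simps)
    then show ?thesis using that unfolding Box_def by (auto simp: PiE_iff space_PiM)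
  qed
  have Box_sub: "Box k c \<subseteq> space ?M" for k c unfolding Box_def by (auto simp: space_PiM PiE_iff)
  have AZ: "A k = (\<Union>c\<in>Z k. Box k c)" for k
  proof (intro equalityI subsetI)
    fix x assume "x \<in> A k"
    then have x: "x \<in> space ?M" "E (g k x) \<in> F" unfolding A_def by auto
    define c where "c = restrict (\<lambda>i. \<lfloor>real (Suc k) * (x i + \<tau> i)\<rfloor>) {..<m}"
    have "E (\<lambda>i. of_int (c i) / real (Suc k) - \<tau> i) = E (g k x)" unfolding E_def c_def g_def by simp
    then have "c \<in> Z k" using x(2) unfolding Z_def c_def by auto
    moreover have "x \<in> Box k c" using Box_iff[OF x(1)] unfolding c_def by simp
    ultimately show "x \<in> (\<Union>c\<in>Z k. Box k c)" by blast
  next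
    fix x assume "x \<in> (\<Union>c\<in>Z k. Box k c)"
    then obtain c where c: "c \<in> Z k" "x \<in> Box k c" by blast
    have x: "x \<in> space ?M" using c(2) Box_sub by blast
    have "E (g k x) = E (\<lambda>i. of_int (c i) / real (Suc k) - \<tau> i)"
      using c(2) unfolding Box_iff[OF x] E_def g_def by simp
    then show "x \<in> A k" using c(1) x unfolding A_def Z_def by simp
  qed
  have Box_meas: "Box k c \<in> sets ?M" for k c unfolding Box_def by (intro sets_PiM_I_finite) auto
  have Box_em: "emeasure ?M (Box k c) = ennreal ((1 / real (Suc k)) ^ m)" for k c
  proof -
    have "emeasure ?M (Box k c) = (\<Prod>i<m. ennreal (1 / real (Suc k)))"
      unfolding Box_def
    proof (subst emeasure_PiM)
      show "(\<Prod>i<m. emeasure lborel {of_int (c i) / real (Suc k) - \<tau> i ..< (of_int (c i) + 1) / real (Suc k) - \<tau> i}) = (\<Prod>i<m. ennreal (1 / real (Suc k)))"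
        by (intro prod.cong refl, subst emeasure_lborel_Ico) (auto simp: field_simps)
    qed auto
    then show ?thesis by (simp add: ennreal_power[symmetric] del: of_nat_Suc)
  qed
  have A_meas: "A k \<in> sets ?M" for k unfolding AZ using finZ Box_meas by (intro sets.finite_UN) auto
  have measA: "measure ?M (A k) = real (lattice_count (Suc k) F) / real (Suc k) ^ m" for k
  proof -
    have "disjoint_family_on (Box k) (Z k)"
      unfolding disjoint_family_on_def
    proof (intro ballI impI)
      fix c c' assume c: "c \<in> Z k" "c' \<in> Z k" "c \<noteq> c'"
      show "Box k c \<inter> Box k c' = {}"
      proof (rule ccontr)
        assume "Box k c \<inter> Box k c' \<noteq> {}"
        then obtain x where x: "x \<in> Box k c" "x \<in> Box k c'" by blast
        then have "x \<in> space ?M" using Box_sub by blast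
        then have "c i = c' i" if "i < m" for i using x Box_iff that by simp
        then show False using c unfolding Z_def by (auto intro!: PiE_ext[of c "{..<m}" _ c'])
      qed
    qed
    then have "measure ?M (A k) = (\<Sum>c\<in>Z k. measure ?M (Box k c))"
      unfolding AZ using finZ Box_meas Box_em by (intro measure_finite_Union) auto
    also have "\<dots> = real (card (Z k)) * (1 / real (Suc k)) ^ m"
      unfolding measure_def Box_em by (simp del: of_nat_Suc)
    finally show ?thesis unfolding cardZ by (simp add: power_divide del: of_nat_Suc)
  qed
  obtain K where K: "\<And>i y. i < m \<Longrightarrow> y \<in> F \<Longrightarrow> \<bar>\<psi> i (y - p)\<bar> \<le> K"
  proof -
    have "\<exists>K. \<forall>y\<in>F. \<bar>\<psi> i (y - p)\<bar> \<le> K" if "i < m" for i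
    proof -
      have "bounded ((\<lambda>y. y - p) ` F)" using bounded_translation_minus[OF polytope_imp_bounded[OF F(1)]] .
      then have "bounded (\<psi> i ` (\<lambda>y. y - p) ` F)"
        using bounded_linear_image linear_conv_bounded_linear \<psi>(1)[OF that] by blast
      then show ?thesis unfolding bounded_iff by auto
    qed
    then obtain K where K: "\<And>i y. i < m \<Longrightarrow> y \<in> F \<Longrightarrow> \<bar>\<psi> i (y - p)\<bar> \<le> K i" by metis
    have "\<bar>\<psi> i (y - p)\<bar> \<le> (\<Sum>j<m. \<bar>K j\<bar>)" if "i < m" "y \<in> F" for i y
    proof -
      have "\<bar>K i\<bar> \<le> (\<Sum>j<m. \<bar>K j\<bar>)" using that(1) by (intro member_le_sum) auto
      then show ?thesis using K[OF that] by linarith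
    qed
    then show ?thesis by (rule that)
  qed
  \<comment> \<open>A box independent of \<open>k\<close>, for domination: \<open>K\<close> bounds
    the coordinates of points of \<open>F\<close>, and the added 1 covers the rounding
    error.\<close>
  define W where "W = (\<Pi>\<^sub>E i\<in>{..<m}. {- (K + 1) .. K + 1})"
  have W_meas: "W \<in> sets ?M" unfolding W_def by (intro sets_PiM_I_finite) auto
  have W_fin: "emeasure ?M W < \<infinity>"
    unfolding W_def by (subst emeasure_PiM) (auto simp: less_top[symmetric] emeasure_lborel_Icc_eq power_eq_top_ennreal)
  have AW: "A k \<subseteq> W" for k
  proof
    fix x assume "x \<in> A k"
    then have x: "x \<in> space ?M" "E (g k x) \<in> F" unfolding A_def by auto
    have "\<bar>x i\<bar> \<le> K + 1" if i: "i < m" for i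
    proof -
      have "\<psi> i (E (g k x) - p) = g k x i" unfolding E_def using \<psi>(2)[OF i] by simp
      then have "\<bar>g k x i\<bar> \<le> K" using K[OF i x(2)] by simp
      moreover have "\<bar>g k x i - x i\<bar> \<le> 1"
        using g_le[of k x i] by (rule order_trans) (simp add: field_simps)
      ultimately show ?thesis by linarith
    qed
    then show "x \<in> W" using x(1) unfolding W_def by (auto simp: PiE_iff space_PiM abs_le_iff) (smt (verit))+
  qed
  have "(\<lambda>k. integral\<^sup>L ?M (indicator (A k) :: _ \<Rightarrow> real)) \<longlonglongrightarrow> integral\<^sup>L ?M (indicator T :: _ \<Rightarrow> real)"
  proof (rule integral_dominated_convergence)
    show "integrable ?M (indicator W :: _ \<Rightarrow> real)" using W_meas W_fin by (intro integrable_real_indicator)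
    show "AE x in ?M. norm (indicator (A k) x :: real) \<le> indicator W x" for k
      using AW[of k] by (intro AE_I2) (auto simp: indicator_def)
    \<comment> \<open>Off these null sets a point of \<open>T\<close> satisfies all inequalities
      strictly, so its rounded points eventually do too; a point outside \<open>T\<close> violates
      one strictly, and so do they eventually.\<close>
    have "AE x in ?M. \<forall>h\<in>H. x \<notin> N h" by (intro AE_finite_allI[OF H(1)] AE_not_in N)
    then show "AE x in ?M. (\<lambda>k. indicator (A k) x :: real) \<longlonglongrightarrow> indicator T x"
      using AE_space
    proof eventually_elim
      case (elim x)
      have lim: "(\<lambda>k. a h \<bullet> E (g k x)) \<longlonglongrightarrow> a h \<bullet> E x" for h
        unfolding aE by (intro tendsto_intros g_lim)
      have ne: "a h \<bullet> E x \<noteq> \<beta> h" if "h \<in> H" for h using elim that unfolding N_def aE by auto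
      have "\<forall>\<^sub>F k in sequentially. (x \<in> A k) = (x \<in> T)"
      proof (cases "x \<in> T")
        case True
        then have "a h \<bullet> E x < \<beta> h" if "h \<in> H" for h
          using ne[OF that] that unfolding T_def EF by (auto simp: less_le)
        then have "\<forall>\<^sub>F k in sequentially. a h \<bullet> E (g k x) < \<beta> h" if "h \<in> H" for h
          using order_tendstoD(2)[OF lim] that by blast
        then have "\<forall>\<^sub>F k in sequentially. \<forall>h\<in>H. a h \<bullet> E (g k x) < \<beta> h"
          using H(1) by (intro eventually_ball_finite) auto
        then show ?thesis
        proof (rule eventually_mono)
          fix k assume "\<forall>h\<in>H. a h \<bullet> E (g k x) < \<beta> h"
          then have "E (g k x) \<in> F" unfolding EF by (auto intro: less_imp_le)
          then show "(x \<in> A k) = (x \<in> T)" using True elim(2) unfolding A_def by simp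
        qed
      next
        case False
        then obtain h where h: "h \<in> H" "\<beta> h < a h \<bullet> E x" using elim(2) unfolding T_def EF by auto
        have "\<forall>\<^sub>F k in sequentially. \<beta> h < a h \<bullet> E (g k x)" using order_tendstoD(1)[OF lim h(2)] .
        then show ?thesis
        proof (rule eventually_mono)
          fix k assume "\<beta> h < a h \<bullet> E (g k x)"
          then have "E (g k x) \<notin> F" unfolding EF using h(1) by (auto simp: not_le)
          then show "(x \<in> A k) = (x \<in> T)" using False unfolding A_def by simp
        qed
      qed
      then have "\<forall>\<^sub>F k in sequentially. indicator (A k) x = (indicator T x :: real)"
        by (rule eventually_mono) (auto simp: indicator_def)
      then show ?case by (rule tendsto_eventually)
    qed
  qed (use T A_meas in auto)
  moreover have "integral\<^sup>L ?M (indicator S :: _ \<Rightarrow> real) = measure ?M S" if "S \<in> sets ?M" for S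
    using sets.Int_space_eq2[OF that] by simp
  ultimately have "(\<lambda>k. measure ?M (A k)) \<longlonglongrightarrow> measure ?M T" using T A_meas by simp
  then show ?thesis unfolding measA T_def E_def .
qed

section \<open>Ehrhart polynomials of lattice complexes\<close>

lemma ehrhart_rel_interior:
  fixes P :: "(real^'n) set"
  assumes P: "polytope P" "P \<noteq> {}" and lat: "\<And>v. v extreme_point_of P \<Longrightarrow> lattice_pt v"
  shows "\<exists>p::real poly. degree p \<le> nat (aff_dim P) \<and> poly p 0 = (- 1) ^ nat (aff_dim P) \<and>
    (\<forall>k\<ge>1. real (lattice_count k (rel_interior P)) = poly p (real k))"
proof -
  let ?ri = "\<lambda>\<sigma> :: (real^'n) set. rel_interior (convex hull \<sigma>)"
  obtain \<T> where \<T>: "finite \<T>"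
    "\<And>\<sigma>. \<sigma> \<in> \<T> \<Longrightarrow> \<sigma> \<noteq> {}" "\<And>\<sigma>. \<sigma> \<in> \<T> \<Longrightarrow> \<not> affine_dependent \<sigma>"
    "\<And>\<sigma>. \<sigma> \<in> \<T> \<Longrightarrow> \<sigma> \<subseteq> {v. v extreme_point_of P}"
    "disjoint_family_on ?ri \<T>" "(\<Union>\<sigma>\<in>\<T>. ?ri \<sigma>) = rel_interior P"
    using polytope_open_triangulation[OF P(1)] by metis
  have fin: "finite \<sigma>" if "\<sigma> \<in> \<T>" for \<sigma> using \<T>(3)[OF that] aff_independent_finite by blast
  have dim: "nat (aff_dim (convex hull \<sigma>)) = card \<sigma> - 1" if "\<sigma> \<in> \<T>" for \<sigma>
    unfolding aff_dim_convex_hull using aff_dim_affine_independent[OF \<T>(3)[OF that]] by linarith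
  have "card \<sigma> - 1 \<le> nat (aff_dim P)" if "\<sigma> \<in> \<T>" for \<sigma>
  proof -
    have "\<sigma> \<subseteq> P" using \<T>(4)[OF that] unfolding extreme_point_of_def by blast
    then have "convex hull \<sigma> \<subseteq> P" using polytope_imp_convex[OF P(1)] by (simp add: hull_minimal)
    then show ?thesis using aff_dim_subset dim[OF that] by (metis nat_mono)
  qed
  note le = this
  have "\<exists>p::real poly. degree p \<le> card \<sigma> - 1 \<and> poly p 0 = (- 1) ^ (card \<sigma> - 1) \<and>
    (\<forall>k\<ge>1. real (lattice_count k (?ri \<sigma>)) = poly p (real k))" if "\<sigma> \<in> \<T>" for \<sigma>
    using \<T>(4)[OF that] lat by (intro lattice_count_open_simplex \<T>(2,3) that) auto
  then obtain q :: "(real^'n) set \<Rightarrow> real poly" where q: "\<And>\<sigma>. \<sigma> \<in> \<T> \<Longrightarrow> degree (q \<sigma>) \<le> card \<sigma> - 1"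
    "\<And>\<sigma>. \<sigma> \<in> \<T> \<Longrightarrow> poly (q \<sigma>) 0 = (- 1) ^ (card \<sigma> - 1)"
    "\<And>\<sigma> k. \<sigma> \<in> \<T> \<Longrightarrow> k \<ge> 1 \<Longrightarrow> real (lattice_count k (?ri \<sigma>)) = poly (q \<sigma>) (real k)"
    by metis
  define p where "p = (\<Sum>\<sigma>\<in>\<T>. q \<sigma>)"
  have "degree p \<le> nat (aff_dim P)"
    unfolding p_def using \<T>(1) q(1) le by (intro degree_sum_le) (auto intro: order_trans)
  moreover have "real (lattice_count k (rel_interior P)) = poly p (real k)" if k: "k \<ge> 1" for k
  proof -
    have bd: "bounded (?ri \<sigma>)" if "\<sigma> \<in> \<T>" for \<sigma>
      using bounded_subset[OF bounded_convex_hull[OF finite_imp_bounded[OF fin[OF that]]] rel_interior_subset] .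
    have "lattice_count k (rel_interior P) = (\<Sum>\<sigma>\<in>\<T>. lattice_count k (?ri \<sigma>))"
      unfolding \<T>(6)[symmetric] using \<T>(1,5) bd k by (intro lattice_count_UN) auto
    then show ?thesis unfolding p_def poly_sum using q(3) k by simp
  qed
  moreover have "poly p 0 = (- 1) ^ nat (aff_dim P)"
  proof -
    \<comment> \<open>The index \<open>None\<close> keeps \<open>P\<close> apart from the pieces
      even when \<open>P\<close> is itself one of the simplices.\<close>
    define C where "C j = (case j of None \<Rightarrow> P | Some \<sigma> \<Rightarrow> convex hull \<sigma>)" for j
    define \<alpha> where "\<alpha> j = (case j of None \<Rightarrow> - 1 | Some (\<sigma> :: (real^'n) set) \<Rightarrow> (1 :: real))" for j
    have simps: "C None = P" "C (Some \<sigma>) = convex hull \<sigma>" "\<alpha> None = - 1" "\<alpha> (Some \<sigma>) = 1" for \<sigma>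
      unfolding C_def \<alpha>_def by auto
    let ?I = "insert None (Some ` \<T>)"
    have sum_I: "(\<Sum>j\<in>?I. f j) = f None + (\<Sum>\<sigma>\<in>\<T>. f (Some \<sigma>))" for f :: "_ \<Rightarrow> real"
      using \<T>(1) by (simp add: sum.reindex o_def)
    have "(\<Sum>j\<in>?I. \<alpha> j * (- 1) ^ nat (aff_dim (C j))) = 0"
    proof (rule euler_additive)
      show "polytope (C j)" "C j \<noteq> {}" if "j \<in> ?I" for j
        using that P \<T>(2) polytope_convex_hull[OF fin] by (auto simp: simps)
      fix x
      show "(\<Sum>j\<in>?I. if x \<in> rel_interior (C j) then \<alpha> j else 0) = 0"
      proof (cases "x \<in> rel_interior P")
        case True
        then obtain \<sigma> where \<sigma>: "\<sigma> \<in> \<T>" "x \<in> ?ri \<sigma>" using \<T>(6) by blast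
        have "(if x \<in> ?ri \<tau> then 1 else 0) = (if \<tau> = \<sigma> then 1 else 0 :: real)" if "\<tau> \<in> \<T>" for \<tau>
          using \<sigma> that \<T>(5) unfolding disjoint_family_on_def by auto
        then have "(\<Sum>\<tau>\<in>\<T>. if x \<in> ?ri \<tau> then 1 else 0 :: real) = 1" using \<sigma>(1) \<T>(1) by simp
        then show ?thesis unfolding sum_I simps using True by simp
      next
        case False
        then have "x \<notin> ?ri \<tau>" if "\<tau> \<in> \<T>" for \<tau> using \<T>(6) that by blast
        then show ?thesis unfolding sum_I simps using False by simp
      qed
    qed (use \<T>(1) in simp)
    then have "(\<Sum>\<sigma>\<in>\<T>. (- 1) ^ nat (aff_dim (convex hull \<sigma>))) = (- 1 :: real) ^ nat (aff_dim P)"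
      unfolding sum_I simps by simp
    then show ?thesis unfolding p_def poly_sum using q(2) dim by simp
  qed
  ultimately show ?thesis by blast
qed

lemma poly_over_power_tendsto:
  fixes p :: "real poly"
  assumes "degree p \<le> m"
  shows "(\<lambda>k. poly p (real (Suc k)) / real (Suc k) ^ m) \<longlonglongrightarrow> coeff p m"
proof -
  have poly_eq: "poly p x = (\<Sum>i\<le>m. coeff p i * x ^ i)" for x
    unfolding poly_altdef using assms by (intro sum.mono_neutral_left) (auto simp: coeff_eq_0)
  have term_lim: "(\<lambda>k. coeff p i * inverse (real (Suc k)) ^ (m - i)) \<longlonglongrightarrow> (if i = m then coeff p m else 0)" if "i \<le> m" for i
  proof (cases "i = m")
    case False
    have "(\<lambda>k. coeff p i * inverse (real (Suc k)) ^ (m - i)) \<longlonglongrightarrow> coeff p i * 0 ^ (m - i)"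
      by (intro tendsto_intros LIMSEQ_inverse_real_of_nat)
    then show ?thesis using False that by (simp add: power_0_left del: of_nat_Suc)
  qed simp
  have "poly p (real (Suc k)) / real (Suc k) ^ m = (\<Sum>i\<le>m. coeff p i * inverse (real (Suc k)) ^ (m - i))" for k
    unfolding poly_eq sum_divide_distrib
  proof (intro sum.cong refl)
    fix i assume "i \<in> {..m}"
    then have "real (Suc k) ^ m = real (Suc k) ^ i * real (Suc k) ^ (m - i)" by (simp flip: power_add del: of_nat_Suc)
    then show "coeff p i * real (Suc k) ^ i / real (Suc k) ^ m = coeff p i * inverse (real (Suc k)) ^ (m - i)"
      by (simp add: power_inverse divide_inverse del: of_nat_Suc)
  qed
  moreover have "(\<lambda>k. \<Sum>i\<le>m. coeff p i * inverse (real (Suc k)) ^ (m - i)) \<longlonglongrightarrow> (\<Sum>i\<le>m. if i = m then coeff p m else 0)"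
    by (intro tendsto_sum term_lim) simp
  ultimately show ?thesis by simp
qed

lemma lattice_count_faces:
  fixes P :: "(real^'n) set"
  assumes "polytope P" "k \<ge> 1"
  shows "lattice_count k P = (\<Sum>H | H face_of P \<and> H \<noteq> {}. lattice_count k (rel_interior H))"
proof -
  have fin: "finite {H. H face_of P \<and> H \<noteq> {}}"
    using finite_polytope_faces[OF assms(1)] by (rule rev_finite_subset) auto
  have "(\<Union>H\<in>{H. H face_of P \<and> H \<noteq> {}}. rel_interior H) = P"
  proof
    show "(\<Union>H\<in>{H. H face_of P \<and> H \<noteq> {}}. rel_interior H) \<subseteq> P"
      using face_of_imp_subset rel_interior_subset by blast
    show "P \<subseteq> (\<Union>H\<in>{H. H face_of P \<and> H \<noteq> {}}. rel_interior H)"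
      using polytope_in_rel_interior_of_face[OF assms(1)] by fastforce
  qed
  moreover have "disjoint_family_on rel_interior {H. H face_of P \<and> H \<noteq> {}}"
    unfolding disjoint_family_on_def using face_of_eq by blast
  moreover have "bounded (rel_interior H)" if "H face_of P" for H
    using polytope_imp_bounded[OF assms(1)] bounded_subset face_of_imp_subset[OF that] rel_interior_subset by metis
  ultimately show ?thesis
    using lattice_count_UN[OF fin, of rel_interior k] assms(2) by simp
qed

text \<open>The volume limit concerns the closed polytope and \<open>p\<close> its relative
  interior. The two counts differ by the proper faces, whose polynomials have smaller degree, so the
  leading coefficient is the same.\<close>

lemma ehrhart_leading_coeff:
  fixes F :: "(real^'n) set" and p :: "real poly"
  assumes F: "polytope F" "F \<noteq> {}" and lat: "\<And>v. v extreme_point_of F \<Longrightarrow> lattice_pt v"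
    and p: "degree p \<le> nat (aff_dim F)" "\<And>k. k \<ge> 1 \<Longrightarrow> real (lattice_count k (rel_interior F)) = poly p (real k)"
  shows "coeff p (nat (aff_dim F)) = lattice_vol F"
proof -
  define m where "m = nat (aff_dim F)"
  define G where "G = {H. H face_of F \<and> H \<noteq> {}} - {F}"
  have G: "H face_of F" "H \<noteq> {}" "H \<noteq> F" if "H \<in> G" for H using that unfolding G_def by auto
  have "\<exists>q::real poly. degree q \<le> nat (aff_dim H) \<and> (\<forall>k\<ge>1. real (lattice_count k (rel_interior H)) = poly q (real k))"
    if H: "H \<in> G" for H
  proof -
    have "polytope H" using G(1)[OF H] F(1) face_of_polytope_polytope by blast
    moreover have "lattice_pt v" if "v extreme_point_of H" for v
      using lat that extreme_point_of_face[OF G(1)[OF H]] by blast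
    ultimately show ?thesis using ehrhart_rel_interior[of H] G(2)[OF H] by blast
  qed
  then obtain q :: "(real^'n) set \<Rightarrow> real poly" where q: "\<And>H. H \<in> G \<Longrightarrow> degree (q H) \<le> nat (aff_dim H)"
    "\<And>H k. H \<in> G \<Longrightarrow> k \<ge> 1 \<Longrightarrow> real (lattice_count k (rel_interior H)) = poly (q H) (real k)" by metis
  have fin: "finite {H. H face_of F \<and> H \<noteq> {}}"
    using finite_polytope_faces[OF F(1)] by (rule rev_finite_subset) auto
  have finG: "finite G" using fin unfolding G_def by simp
  have deg: "degree (q H) < m" if H: "H \<in> G" for H
  proof -
    have "aff_dim H < aff_dim F"
      using face_of_aff_dim_lt[OF polytope_imp_convex[OF F(1)] G(1,3)[OF H]] .
    moreover have "aff_dim H \<ge> 0" using G(2)[OF H] by (metis aff_dim_negative_iff not_less)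
    ultimately show ?thesis using q(1)[OF H] unfolding m_def by linarith
  qed
  define P where "P = p + (\<Sum>H\<in>G. q H)"
  have "degree P \<le> m"
    unfolding P_def using p(1) deg finG by (intro degree_add_le degree_sum_le) (auto simp: m_def less_imp_le)
  then have "(\<lambda>k. poly P (real (Suc k)) / real (Suc k) ^ m) \<longlonglongrightarrow> coeff P m" by (rule poly_over_power_tendsto)
  moreover have "coeff P m = coeff p m"
    unfolding P_def coeff_add coeff_sum using deg by (simp add: coeff_eq_0)
  moreover have "poly P (real k) = real (lattice_count k F)" if "k \<ge> 1" for k
  proof -
    have "F \<in> {H. H face_of F \<and> H \<noteq> {}}" using F face_of_refl polytope_imp_convex by blast
    then have "lattice_count k F = lattice_count k (rel_interior F) + (\<Sum>H\<in>G. lattice_count k (rel_interior H))"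
      unfolding lattice_count_faces[OF F(1) that] G_def by (rule sum.remove[OF fin])
    then show ?thesis unfolding P_def using p(2)[OF that] q(2)[OF _ that] by (simp add: poly_sum)
  qed
  ultimately have lim: "(\<lambda>k. real (lattice_count (Suc k) F) / real (Suc k) ^ m) \<longlonglongrightarrow> coeff p m" by (simp del: of_nat_Suc)
  define b where "b = (SOME b. lattice_basis (parallel_space F) m b)"
  obtain B where B: "finite B" "independent B" "\<And>u. u \<in> B \<Longrightarrow> lattice_pt u" "int (card B) = aff_dim F"
    "parallel_space F = span B"
    using parallel_space_lattice_polytope[OF F lat] by metis
  \<comment> \<open>The limit is the volume for any lattice basis and base point, so the choices
    made in \<open>lattice_vol\<close> only require existence.\<close>
  have "\<exists>b. lattice_basis (parallel_space F) m b"
    using lattice_basis_exists[OF B(1-3)] B(4,5) unfolding m_def by (metis nat_int)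
  then have b: "lattice_basis (parallel_space F) m b" unfolding b_def by (rule someI_ex)
  define x where "x = (SOME x. x \<in> F)"
  have x: "x \<in> F" unfolding x_def using F(2) by (simp add: some_in_eq)
  have "coeff p m = measure (PiM {..<m} (\<lambda>_. lborel)) {t \<in> space (PiM {..<m} (\<lambda>_. lborel)). x + (\<Sum>i<m. t i *\<^sub>R b i) \<in> F}"
    using LIMSEQ_unique[OF lim lattice_count_tendsto_volume[OF F lat b x]] .
  then show ?thesis unfolding lattice_vol_def Let_def m_def b_def x_def .
qed

text \<open>Every point lies in the relative interior of a face of some cell, which is again a cell.
  If two cells share a relative interior point, their intersection is a face of each that meets its
  relative interior, so both equal it.\<close>

lemma B_count_lattice_complex:
  fixes R :: "(real^'n) set set"
  assumes R: "lattice_complex R" and k: "k \<ge> 1"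
  shows "B_count k R = int (\<Sum>C\<in>R. lattice_count k (rel_interior C))"
proof -
  have fin: "finite R" and poly: "\<And>C. C \<in> R \<Longrightarrow> polytope C"
    and face: "\<And>C F. C \<in> R \<Longrightarrow> F face_of C \<Longrightarrow> F \<noteq> {} \<Longrightarrow> F \<in> R"
    and int: "\<And>C D. C \<in> R \<Longrightarrow> D \<in> R \<Longrightarrow> (C \<inter> D) face_of C \<and> (C \<inter> D) face_of D"
    using R unfolding lattice_complex_def by blast+
  have "\<Union>R = (\<Union>C\<in>R. rel_interior C)"
  proof
    show "(\<Union>C\<in>R. rel_interior C) \<subseteq> \<Union>R" using rel_interior_subset by blast
    show "\<Union>R \<subseteq> (\<Union>C\<in>R. rel_interior C)"
    proof
      fix x assume "x \<in> \<Union>R"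
      then obtain C where C: "C \<in> R" "x \<in> C" by blast
      obtain H where H: "H face_of C" "x \<in> rel_interior H"
        using polytope_in_rel_interior_of_face[OF poly[OF C(1)] C(2)] by blast
      have "H \<noteq> {}" using H(2) by auto
      then show "x \<in> (\<Union>C\<in>R. rel_interior C)" using face[OF C(1) H(1)] H(2) by blast
    qed
  qed
  moreover have "disjoint_family_on rel_interior R"
    unfolding disjoint_family_on_def
  proof (intro ballI impI, rule ccontr)
    fix C D assume CD: "C \<in> R" "D \<in> R" "C \<noteq> D" "rel_interior C \<inter> rel_interior D \<noteq> {}"
    then obtain x where x: "x \<in> rel_interior C" "x \<in> rel_interior D" by blast
    then have "x \<in> C \<inter> D" using rel_interior_subset by blast
    then have "C \<inter> D = C" "C \<inter> D = D"
      using int[OF CD(1,2)] x face_of_disjoint_rel_interior by blast+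
    then show False using CD(3) by simp
  qed
  moreover have "bounded (rel_interior C)" if "C \<in> R" for C
    using polytope_imp_bounded[OF poly[OF that]] bounded_subset rel_interior_subset by metis
  ultimately have "lattice_count k (\<Union>R) = (\<Sum>C\<in>R. lattice_count k (rel_interior C))"
    using lattice_count_UN[OF fin, of rel_interior k] k by simp
  then show ?thesis using k unfolding B_count_def lattice_count_def by simp
qed

text \<open>The identity holds for every lattice complex of dimension at most \<open>d\<close>:
  cells of smaller dimension have polynomials of degree below \<open>d\<close> and drop out of the
  difference.\<close>

lemma lattice_complex_volume:
  fixes R :: "(real^'n) set set"
  assumes R: "lattice_complex R" and dim: "\<And>C. C \<in> R \<Longrightarrow> aff_dim C \<le> int d"
  shows "(\<Sum>F\<in>{F \<in> R. aff_dim F = int d}. fact d * lattice_vol F)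
       = (-1) ^ d * (\<Sum>k=0..d. (-1) ^ k * real (d choose k) * real_of_int (B_count k R))"
proof -
  have fin: "finite R" and cell: "\<And>C. C \<in> R \<Longrightarrow> polytope C" "\<And>C. C \<in> R \<Longrightarrow> C \<noteq> {}"
    "\<And>C v. C \<in> R \<Longrightarrow> v extreme_point_of C \<Longrightarrow> lattice_pt v"
    using R unfolding lattice_complex_def by blast+
  have "\<exists>p::real poly. degree p \<le> nat (aff_dim C) \<and> poly p 0 = (- 1) ^ nat (aff_dim C) \<and>
    (\<forall>k\<ge>1. real (lattice_count k (rel_interior C)) = poly p (real k))" if "C \<in> R" for C
    using cell[OF that] by (intro ehrhart_rel_interior)
  then obtain p :: "(real^'n) set \<Rightarrow> real poly" where p: "\<And>C. C \<in> R \<Longrightarrow> degree (p C) \<le> nat (aff_dim C)"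
    "\<And>C. C \<in> R \<Longrightarrow> poly (p C) 0 = (- 1) ^ nat (aff_dim C)"
    "\<And>C k. C \<in> R \<Longrightarrow> k \<ge> 1 \<Longrightarrow> real (lattice_count k (rel_interior C)) = poly (p C) (real k)" by metis
  \<comment> \<open>The convention for \<open>B_count 0\<close> enters here: the Euler
    characteristic is the sum of the constant terms, so one polynomial covers \<open>k = 0\<close>
    as well.\<close>
  have B: "real_of_int (B_count k R) = (\<Sum>C\<in>R. poly (p C) (real k))" for k
  proof (cases "k = 0")
    case True
    then show ?thesis using p(2) unfolding B_count_def euler_char_def by simp
  next
    case False
    then show ?thesis using p(3) by (simp add: B_count_lattice_complex[OF R])
  qed
  have deg: "degree (p C) \<le> d" if "C \<in> R" for C using p(1)[OF that] dim[OF that] by linarith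
  have lead: "coeff (p C) d = (if aff_dim C = int d then lattice_vol C else 0)" if C: "C \<in> R" for C
  proof (cases "aff_dim C = int d")
    case True
    then show ?thesis using ehrhart_leading_coeff[OF cell(1,2)[OF C] cell(3)[OF C] p(1)[OF C] p(3)[OF C]] by simp
  next
    case False
    have "aff_dim C \<ge> 0" using cell(2)[OF C] by (metis aff_dim_negative_iff not_less)
    then have "degree (p C) < d" using p(1)[OF C] dim[OF C] False by linarith
    then show ?thesis using False by (simp add: coeff_eq_0)
  qed
  have "(\<Sum>k=0..d. (-1) ^ k * real (d choose k) * real_of_int (B_count k R)) =
     (\<Sum>C\<in>R. \<Sum>k=0..d. (-1) ^ k * real (d choose k) * poly (p C) (real k))"
    unfolding B sum_distrib_left by (rule sum.swap)
  also have "\<dots> = (\<Sum>C\<in>R. (-1) ^ d * fact d * coeff (p C) d)"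
    using binomial_alternating_sum_poly[OF deg] by (intro sum.cong) auto
  also have "(-1) ^ d * \<dots> = (\<Sum>C\<in>R. fact d * coeff (p C) d)"
    by (simp add: sum_distrib_left mult.assoc[symmetric] power_add[symmetric] flip: mult_2)
  also have "\<dots> = (\<Sum>C\<in>R. if aff_dim C = int d then fact d * lattice_vol C else 0)"
    using lead by (intro sum.cong) auto
  also have "\<dots> = (\<Sum>F\<in>{F \<in> R. aff_dim F = int d}. fact d * lattice_vol F)"
    using fin by (simp add: sum.inter_filter)
  finally show ?thesis by simp
qed

section \<open>The boundary complex\<close>

lemma lattice_complex_boundary_complex:
  assumes "lattice_complex Q"
  shows "lattice_complex (boundary_complex Q)"
proof -
  have "F \<subseteq> frontier (\<Union>Q)" if "F face_of C" "C \<subseteq> frontier (\<Union>Q)" for F C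
    using that face_of_imp_subset by blast
  then show ?thesis using assms unfolding lattice_complex_def boundary_complex_def by auto
qed

text \<open>A full-dimensional cell has interior points; these are interior to the union and cannot
  lie on its frontier.\<close>

lemma aff_dim_boundary_complex:
  fixes Q :: "(real^'n) set set"
  assumes "C \<in> boundary_complex Q" "convex C" "C \<noteq> {}"
  shows "aff_dim C \<le> int (CARD('n) - 1)"
proof -
  have C: "C \<in> Q" "C \<subseteq> frontier (\<Union>Q)" using assms(1) unfolding boundary_complex_def by auto
  have "aff_dim C \<noteq> int CARD('n)"
  proof
    assume "aff_dim C = int CARD('n)"
    then have "rel_interior C = interior C" by (intro interior_rel_interior) simp
    then obtain x where x: "x \<in> interior C" using assms(2,3) rel_interior_eq_empty by blast
    then have "x \<in> interior (\<Union>Q)" using C(1) interior_mono[of C "\<Union>Q"] by blast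
    moreover have "x \<in> frontier (\<Union>Q)" using x C(2) interior_subset by blast
    ultimately show False unfolding frontier_def by blast
  qed
  moreover have "aff_dim C \<le> int CARD('n)" using aff_dim_le_DIM[of C] by simp
  moreover have "CARD('n) > 0" by simp
  ultimately show ?thesis by linarith
qed

theorem theorem4p7:
  fixes Q :: "(real^'n) set set"
  assumes "lattice_complex Q"
    and "pure_complex Q CARD('n)"
  shows "(\<Sum>F\<in>{F \<in> boundary_complex Q. aff_dim F = int CARD('n) - 1}.
            fact (CARD('n) - 1) * lattice_vol F)
       = (-1) ^ (CARD('n) - 1) *
         (\<Sum>k=0..CARD('n) - 1. (-1) ^ k * real ((CARD('n) - 1) choose k)
                                 * real_of_int (B_count k (boundary_complex Q)))"
proof -
  have "lattice_complex (boundary_complex Q)"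
    using lattice_complex_boundary_complex[OF assms(1)] .
  moreover have "aff_dim C \<le> int (CARD('n) - 1)" if C: "C \<in> boundary_complex Q" for C
  proof -
    have "polytope C" "C \<noteq> {}"
      using C assms(1) unfolding boundary_complex_def lattice_complex_def by auto
    then show ?thesis using aff_dim_boundary_complex[OF C] polytope_imp_convex by blast
  qed
  ultimately have "(\<Sum>F\<in>{F \<in> boundary_complex Q. aff_dim F = int (CARD('n) - 1)}. fact (CARD('n) - 1) * lattice_vol F)
       = (-1) ^ (CARD('n) - 1) * (\<Sum>k=0..CARD('n) - 1. (-1) ^ k * real ((CARD('n) - 1) choose k)
                                 * real_of_int (B_count k (boundary_complex Q)))"
    by (rule lattice_complex_volume)
  moreover have "int (CARD('n) - 1) = int CARD('n) - 1" by (simp add: of_nat_diff)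
  ultimately show ?thesis by simp
qed

end
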